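(* Consider the CMC hierarchy with extended Maurer–Cartan form $\boldsymbol\phi$ and canonical formal Killing field $\mathbf Y$, as defined in the context. Let $\mathcal D=\mathcal L_{\lambda\partial_\lambda}$ be the Euler operator in the spectral parameter $\lambda$ (so $\mathcal D$ multiplies the coefficient of $\lambda^k$ by $k$), and set $$\varphi_{\mathbf Y}:=\mathrm{tr}\big(\mathbf Y\,\mathcal D(\boldsymbol\phi)\big),$$ a 1-form with coefficients in formal series in $\lambda^{-2},\lambda^2$. Then: a) $d\varphi_{\mathbf Y}=0$. When $\varphi_{\mathbf Y}$ is expanded as a formal series in $\lambda^{-2},\lambda^2$, each coefficient represents a conservation law of the CMC hierarchy. b) $\varphi_{\mathbf Y}$ represents an extension of the sequence of conservation laws $\varphi^n=c^{2n+2}\xi+b^{2n}\bar\xi$ $(n\ge0)$ of the CMC system, in the sense that $$\varphi_{\mathbf Y}+\mathrm i\,d\mathbf a\equiv-2\gamma\sum_{n=0}^\infty\lambda^{2n}\varphi^n\mod dt_m,\ d\bar t_m\ (m\ge1).$$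
   Context: Everything is formal. Let $\gamma$ be a real constant with $\gamma^2>0$ and $\mathrm i=\sqrt{-1}$. **Original CMC structure equations.** On the infinite jet space of the (complexified) CMC system one has scalar functions $h_j,\bar h_j$ ($j\ge2$), treated as independent, with $h_2,\bar h_2\ne0$ and chosen square roots $h_2^{1/2},\bar h_2^{1/2}$, and 1-forms $\xi,\bar\xi,\rho$ satisfying (modulo the differential ideal of the jet space) $$d\xi=\mathrm i\rho\wedge\xi,\quad d\bar\xi=-\mathrm i\rho\wedge\bar\xi,\quad d\rho=R\tfrac{\mathrm i}{2}\xi\wedge\bar\xi,\quad R=\gamma^2-h_2\bar h_2,\quad dh_j+\mathrm i jh_j\rho=h_{j+1}\xi+T_j\bar\xi,$$ and the formal conjugates of these, where $T_2=0$, $T_{j+1}=\sum_{s=0}^{j-2}\frac{j+s+2}{2j}\binom{j}{s+2}h_{j-s}(\delta_{0s}\gamma^2-h_{2+s}\bar h_2)$ for $j\ge2$. Put $z_j=h_2^{-j/2}h_j$ ($j\ge3$). **Formal complex conjugation** (overline): the multiplicative, conjugate-linear operation ($\mathrm i\mapsto-\mathrm i$, $\gamma\mapsto\gamma$) with $\lambda^{\pm1}\mapsto\lambda^{\mp1}$, $h_j\leftrightarrow\bar h_j$, $t_m\leftrightarrow\bar t_m$, $\xi\leftrightarrow\bar\xi$, $\rho\mapsto\rho$. Superscript $t$ is transpose. **Canonical formal Killing field.** Let $$\phi_\lambda=\begin{pmatrix}\frac{\mathrm i}{2}\rho&-\frac{\lambda}{2}\gamma\bar\xi-\frac{\lambda^{-1}}{2}h_2\xi\\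 \frac{\lambda}{2}\bar h_2\bar\xi+\frac{\lambda^{-1}}{2}\gamma\xi&-\frac{\mathrm i}{2}\rho\end{pmatrix},\quad \phi_0=\begin{pmatrix}\frac{\mathrm i}{2}\rho&0\\0&-\frac{\mathrm i}{2}\rho\end{pmatrix}.$$ The canonical formal Killing field is $$\mathbf Y=\begin{pmatrix}-\mathrm i\mathbf a&2\mathbf c\\2\mathbf b&\mathrm i\mathbf a\end{pmatrix},\quad \mathbf a=\sum_{n\ge0}\lambda^{2n}a^{2n+1},\ \mathbf b=\sum_{n\ge0}\lambda^{2n+1}b^{2n+2},\ \mathbf c=\sum_{n\ge0}\lambda^{2n+1}c^{2n+2}$$ (superscripts on $a,b,c$ are indices), determined by $a^1=0$, $b^2=-\mathrm i\gamma h_2^{-1/2}$, $c^2=\mathrm ih_2^{1/2}$, $\det\mathbf Y=-4\gamma\lambda^2$, and $d\mathbf Y+[\phi_\lambda,\mathbf Y]=0$ with respect to the original CMC structure equations. One has $a^{2n+1},\,h_2^{1/2}b^{2n+2},\,h_2^{-1/2}c^{2n+2}\in\mathbb C[z_3,z_4,\dots]$. By convention $b^0=c^0=0$. In components, the Killing equation reads $$da^{2n+1}=(\mathrm i\gamma c^{2n+2}+\mathrm ih_2b^{2n+2})\xi+(\mathrm i\gamma b^{2n}+\mathrm i\bar h_2c^{2n})\bar\xi,$$ $$db^{2n+2}-\mathrm ib^{2n+2}\rho=\tfrac{\mathrm i\gamma}{2}a^{2n+3}\xi+\tfrac{\mathrm i}{2}\bar h_2a^{2n+1}\bar\xi,\qquad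 dc^{2n+2}+\mathrm ic^{2n+2}\rho=\tfrac{\mathrm i}{2}h_2a^{2n+3}\xi+\tfrac{\mathrm i\gamma}{2}a^{2n+1}\bar\xi.$$ **CMC hierarchy.** New independent variables $t_m,\bar t_m$ ($m\ge0$) are introduced, with $dt_0=-\frac12h_2^{1/2}\xi$, $d\bar t_0=-\frac12\bar h_2^{1/2}\bar\xi$. For $m\ge0$ write $\frac1{2\mathrm i}\lambda^{-2m-2}\mathbf Y=U_m+U_{(m+1)}$, with $U_m$ the terms of $\lambda$-degree $\le-1$ and $U_{(m+1)}$ those of $\lambda$-degree $\ge0$. The extended Maurer–Cartan form is $$\boldsymbol\phi=-\sum_{m\ge1}\bar U_m^t\,d\bar t_m+\phi_\lambda+\sum_{m\ge1}U_m\,dt_m .$$ The CMC hierarchy is the system of structure equations $$d\mathbf Y+[\boldsymbol\phi,\mathbf Y]=0,\quad d(-\bar{\mathbf Y}^t)+[\boldsymbol\phi,(-\bar{\mathbf Y}^t)]=0,\quad d\boldsymbol\phi+\boldsymbol\phi\wedge\boldsymbol\phi=0,$$ together with $d\xi-\mathrm i\rho\wedge\xi=\sum_{m\ge1}a^{2m+3}dt_m\wedge\xi$, $dh_2+2\mathrm ih_2\rho=h_3\xi-2\sum_{m\ge1}h_2a^{2m+3}dt_m$ and the formal conjugates of these two equations. All equalities are understood modulo the differential ideal defined by these equations on the product of the infinite jet space with the spaces of the variables $t_m,\bar t_m$. A 1-form represents a conservation law if it is closed modulo this ideal (the conservation law being its class modulo exact forms and the ideal). *)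

theory Defs
  imports "HOL-Analysis.Analysis"
begin

text \<open>
  The differential forms on (infinite jet space) \<open>\<times>\<close> (space of the variables \<open>t\<^sub>m\<close>, \<open>tbar\<^sub>m\<close>) are
  modelled by a graded-commutative differential algebra over the complex numbers with a formal
  complex conjugation. The whole type \<open>'a\<close> is the total algebra, its product is the wedge product,
  and \<^term>\<open>scal M\<close> embeds the constants. The algebra is topological because the hierarchy involves
  genuinely infinite sums of 1-forms such as \<open>\<Sum>m\<ge>1. a\<^sub>m dt\<^sub>m\<close>.
\<close>

record 'a form_algebra =
  Forms :: "nat \<Rightarrow> 'a set"
  scal :: "complex \<Rightarrow> 'a"
  ext_d :: "'a \<Rightarrow> 'a"
  fbar :: "'a \<Rightarrow> 'a"

locale form_algebra =
  fixes M :: "('a :: {ring_1, topological_ab_group_add, topological_semigroup_mult, t2_space}, 'b)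
                form_algebra_scheme"
  assumes Forms_zero: "0 \<in> Forms M p"
    and Forms_add: "x \<in> Forms M p \<Longrightarrow> y \<in> Forms M p \<Longrightarrow> x + y \<in> Forms M p"
    and Forms_mult: "x \<in> Forms M p \<Longrightarrow> y \<in> Forms M q \<Longrightarrow> x * y \<in> Forms M (p + q)"
    and Forms_closed: "closed (Forms M p)"
    and grading: "\<exists>!c. finite {p. c p \<noteq> 0} \<and> (\<forall>p. c p \<in> Forms M p) \<and> x = (\<Sum>p | c p \<noteq> 0. c p)"
    and graded_comm: "x \<in> Forms M p \<Longrightarrow> y \<in> Forms M q \<Longrightarrow> x * y = (-1) ^ (p * q) * (y * x)"
    and scal_Forms: "scal M z \<in> Forms M 0"
    and scal_one: "scal M 1 = 1"
    and scal_add: "scal M (z + w) = scal M z + scal M w"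
    and scal_mult: "scal M (z * w) = scal M z * scal M w"
    and d_Forms: "x \<in> Forms M p \<Longrightarrow> ext_d M x \<in> Forms M (Suc p)"
    and d_add: "ext_d M (x + y) = ext_d M x + ext_d M y"
    and d_Leibniz: "x \<in> Forms M p \<Longrightarrow> ext_d M (x * y) = ext_d M x * y + (-1) ^ p * (x * ext_d M y)"
    and d_scal: "ext_d M (scal M z) = 0"
    and d_d: "ext_d M (ext_d M x) = 0"
    and d_continuous: "continuous_on UNIV (ext_d M)"
    and bar_Forms: "x \<in> Forms M p \<Longrightarrow> fbar M x \<in> Forms M p"
    and bar_add: "fbar M (x + y) = fbar M x + fbar M y"
    and bar_mult: "fbar M (x * y) = fbar M x * fbar M y"
    and bar_scal: "fbar M (scal M z) = scal M (cnj z)"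
    and bar_bar: "fbar M (fbar M x) = x"
    and bar_d: "fbar M (ext_d M x) = ext_d M (fbar M x)"
    and bar_continuous: "continuous_on UNIV (fbar M)"

text \<open>
  Because infinite sums of elements of an ideal occur, ``the ideal generated by'' is understood in
  the topological sense: the smallest closed ideal, respectively the smallest closed differential
  ideal, containing the given forms.
\<close>

definition closed_ideal :: "'a :: {ring_1, topological_space} set \<Rightarrow> bool" where
  "closed_ideal J \<longleftrightarrow> closed J \<and> 0 \<in> J \<and> (\<forall>x\<in>J. \<forall>y\<in>J. x + y \<in> J)
     \<and> (\<forall>x\<in>J. \<forall>r. r * x \<in> J \<and> x * r \<in> J)"

definition ideal_gen :: "'a :: {ring_1, topological_space} set \<Rightarrow> 'a set" where
  "ideal_gen G = \<Inter>{J. closed_ideal J \<and> G \<subseteq> J}"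

definition diff_ideal_gen ::
    "('a :: {ring_1, topological_space}, 'b) form_algebra_scheme \<Rightarrow> 'a set \<Rightarrow> 'a set" where
  "diff_ideal_gen M G = \<Inter>{J. closed_ideal J \<and> ext_d M ` J \<subseteq> J \<and> G \<subseteq> J}"

text \<open>
  \<^term>\<open>jet M j\<close> is \<open>h\<^sub>j\<close> (only \<open>j \<ge> 2\<close> is used), \<^term>\<open>rt M\<close> and \<^term>\<open>rt_inv M\<close> are the chosen
  \<open>h\<^sub>2\<^bsup>1/2\<^esup>\<close> and its inverse, \<^term>\<open>tim M m\<close> is \<open>t\<^sub>m\<close>. The barred objects are the images under
  \<^term>\<open>fbar M\<close>. No relation between \<open>h\<^sub>j\<close> and its bar is imposed, so they may be independent.
\<close>

record 'a cmc_data = "'a form_algebra" +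
  gam :: real
  xi :: 'a
  rho :: 'a
  jet :: "nat \<Rightarrow> 'a"
  rt :: 'a
  rt_inv :: 'a
  tim :: "nat \<Rightarrow> 'a"

definition dt_beyond ::
    "('a :: {ring_1, topological_space}, 'b) cmc_data_scheme \<Rightarrow> nat \<Rightarrow> 'a set" where
  "dt_beyond M N = {ext_d M (tim M m) | m. m > N} \<union> {ext_d M (fbar M (tim M m)) | m. m > N}"

text \<open>
  The topology is the one of formal infinite sums in the \<open>dt\<^sub>m\<close>, \<open>dtbar\<^sub>m\<close>: a form is small when it
  lies in the closed ideal generated by those with \<open>m > N\<close> for large \<open>N\<close>. By \<open>complete\<close>, every
  family of forms of fixed degree that tends to 0 can be summed, so that all the infinite sums
  below exist: modulo each \<^term>\<open>ideal_gen (dt_beyond M N)\<close> they have finitely many nonzero terms.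
\<close>

locale cmc_forms = form_algebra M
  for M :: "('a :: {ring_1, topological_ab_group_add, topological_semigroup_mult, t2_space}, 'b)
              cmc_data_scheme" +
  assumes gam_pos: "(gam M)\<^sup>2 > 0"
    and xi_Forms: "xi M \<in> Forms M 1"
    and rho_Forms: "rho M \<in> Forms M 1"
    and rho_bar: "fbar M (rho M) = rho M"
    and jet_Forms: "j \<ge> 2 \<Longrightarrow> jet M j \<in> Forms M 0"
    and rt_Forms: "rt M \<in> Forms M 0"
    and rt_inv_Forms: "rt_inv M \<in> Forms M 0"
    and rt_square: "(rt M)\<^sup>2 = jet M 2"
    and rt_inverse: "rt M * rt_inv M = 1"
    and tim_Forms: "tim M m \<in> Forms M 0"
    and topology: "eventually P (nhds 0) \<longleftrightarrow> (\<exists>N. \<forall>x\<in>ideal_gen (dt_beyond M N). P x)"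
    and complete: "(\<forall>n::nat. g n \<in> Forms M p) \<Longrightarrow> g \<longlonglongrightarrow> 0 \<Longrightarrow> g summable_on UNIV"

primrec cmc_T :: "('a :: ring_1, 'b) cmc_data_scheme \<Rightarrow> nat \<Rightarrow> 'a" where
  "cmc_T M 0 = 0"
| "cmc_T M (Suc j) = (if j < 2 then 0 else
     (\<Sum>s = 0..j - 2. scal M (of_nat (j + s + 2) / of_nat (2 * j) * of_nat (j choose (s + 2))) *
        jet M (j - s) *
        ((if s = 0 then scal M (complex_of_real ((gam M)\<^sup>2)) else 0) - jet M (2 + s) * fbar M (jet M 2))))"

definition cmc_eqs :: "('a :: ring_1, 'b) cmc_data_scheme \<Rightarrow> 'a set" where
  "cmc_eqs M = (let
      E = {ext_d M (xi M) - scal M \<i> * rho M * xi M,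
           ext_d M (rho M) - (scal M (complex_of_real ((gam M)\<^sup>2)) - jet M 2 * fbar M (jet M 2)) *
             scal M (\<i> / 2) * xi M * fbar M (xi M)} \<union>
          {ext_d M (jet M j) + scal M (\<i> * of_nat j) * jet M j * rho M
             - (jet M (Suc j) * xi M + cmc_T M j * fbar M (xi M)) | j. j \<ge> 2}
    in E \<union> fbar M ` E)"

definition cmc_ideal :: "('a :: {ring_1, topological_space}, 'b) cmc_data_scheme \<Rightarrow> 'a set" where
  "cmc_ideal M = diff_ideal_gen M (cmc_eqs M)"

text \<open>A two-sided formal series of 2-by-2 matrices maps \<open>k\<close> to the coefficient of \<open>\<lambda>\<^sup>k\<close>.\<close>

type_synonym 'a mseries = "int \<Rightarrow> 'a ^ 2 ^ 2"

definition mat2 :: "'a :: zero \<Rightarrow> 'a \<Rightarrow> 'a \<Rightarrow> 'a \<Rightarrow> 'a ^ 2 ^ 2" where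
  "mat2 p q r s = vector [vector [p, q], vector [r, s]]"

definition ms_mult ::
    "'a :: {ring_1, topological_ab_group_add, t2_space} mseries \<Rightarrow> 'a mseries \<Rightarrow> 'a mseries" where
  "ms_mult P Q k = (\<chi> i j. \<Sum>l\<in>UNIV. \<Sum>\<^sub>\<infinity>n. P n $ i $ l * Q (k - n) $ l $ j)"

definition ms_comm ::
    "'a :: {ring_1, topological_ab_group_add, t2_space} mseries \<Rightarrow> 'a mseries \<Rightarrow> 'a mseries" where
  "ms_comm P Q k = ms_mult P Q k - ms_mult Q P k"

definition ms_d :: "('a, 'b) form_algebra_scheme \<Rightarrow> 'a mseries \<Rightarrow> 'a mseries" where
  "ms_d M P k = map_matrix (ext_d M) (P k)"

text \<open>\<open>P \<mapsto> Pbar\<^sup>t\<close>; the conjugation sends \<open>\<lambda>\<close> to its inverse.\<close>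

definition ms_adj :: "('a, 'b) form_algebra_scheme \<Rightarrow> 'a mseries \<Rightarrow> 'a mseries" where
  "ms_adj M P k = transpose (map_matrix (fbar M) (P (- k)))"

definition ms_euler :: "'a :: ring_1 mseries \<Rightarrow> 'a mseries" where
  "ms_euler P k = map_matrix (\<lambda>x. of_int k * x) (P k)"

definition ms_det :: "'a :: {ring_1, topological_ab_group_add, t2_space} mseries \<Rightarrow> int \<Rightarrow> 'a" where
  "ms_det P k = (\<Sum>\<^sub>\<infinity>n. P n $ 1 $ 1 * P (k - n) $ 2 $ 2 - P n $ 1 $ 2 * P (k - n) $ 2 $ 1)"

definition ms_entries :: "'a mseries \<Rightarrow> 'a set" where
  "ms_entries P = {P k $ i $ j | k i j. True}"

definition phi_lambda :: "('a :: ring_1, 'b) cmc_data_scheme \<Rightarrow> 'a mseries" where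
  "phi_lambda M k =
    (if k = 0 then mat2 (scal M (\<i> / 2) * rho M) 0 0 (- (scal M (\<i> / 2) * rho M))
     else if k = 1 then
       mat2 0 (- (scal M (complex_of_real (gam M) / 2) * fbar M (xi M)))
            (scal M (1 / 2) * fbar M (jet M 2) * fbar M (xi M)) 0
     else if k = -1 then
       mat2 0 (- (scal M (1 / 2) * jet M 2 * xi M))
            (scal M (complex_of_real (gam M) / 2) * xi M) 0
     else 0)"

text \<open>
  The sequences \<open>a\<close>, \<open>b\<close>, \<open>c\<close> are indexed by the superscripts: only \<open>a (2*n+1)\<close>, \<open>b (2*n)\<close> and
  \<open>c (2*n)\<close> are used.
\<close>

definition ser_a :: "(nat \<Rightarrow> 'a :: zero) \<Rightarrow> int \<Rightarrow> 'a" where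
  "ser_a a k = (if k \<ge> 0 \<and> even k then a (nat k + 1) else 0)"

definition ser_bc :: "(nat \<Rightarrow> 'a :: zero) \<Rightarrow> int \<Rightarrow> 'a" where
  "ser_bc b k = (if k \<ge> 0 \<and> odd k then b (nat k + 1) else 0)"

definition killing ::
    "('a :: ring_1, 'b) cmc_data_scheme \<Rightarrow> (nat \<Rightarrow> 'a) \<Rightarrow> (nat \<Rightarrow> 'a) \<Rightarrow> (nat \<Rightarrow> 'a) \<Rightarrow> 'a mseries" where
  "killing M a b c k =
     mat2 (- (scal M \<i> * ser_a a k)) (2 * ser_bc c k) (2 * ser_bc b k) (scal M \<i> * ser_a a k)"

text \<open>The algebra \<open>\<complex>[z\<^sub>3, z\<^sub>4, \<dots>]\<close> with \<open>z\<^sub>j = h\<^sub>2\<^bsup>-j/2\<^esup> h\<^sub>j\<close>.\<close>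

inductive_set z_polys :: "('a :: ring_1, 'b) cmc_data_scheme \<Rightarrow> 'a set"
  for M :: "('a, 'b) cmc_data_scheme" where
  const: "scal M w \<in> z_polys M"
| gen: "j \<ge> 3 \<Longrightarrow> rt_inv M ^ j * jet M j \<in> z_polys M"
| add: "x \<in> z_polys M \<Longrightarrow> y \<in> z_polys M \<Longrightarrow> x + y \<in> z_polys M"
| mult: "x \<in> z_polys M \<Longrightarrow> y \<in> z_polys M \<Longrightarrow> x * y \<in> z_polys M"

definition canonical_killing ::
    "('a :: {ring_1, topological_ab_group_add, t2_space}, 'b) cmc_data_scheme \<Rightarrow>
       (nat \<Rightarrow> 'a) \<Rightarrow> (nat \<Rightarrow> 'a) \<Rightarrow> (nat \<Rightarrow> 'a) \<Rightarrow> bool" where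
  "canonical_killing M a b c \<longleftrightarrow>
     b 0 = 0 \<and> c 0 = 0 \<and> a 1 = 0 \<and>
     b 2 = scal M (- \<i> * complex_of_real (gam M)) * rt_inv M \<and>
     c 2 = scal M \<i> * rt M \<and>
     (\<forall>n. a (2 * n + 1) \<in> z_polys M \<and> rt M * b (2 * n + 2) \<in> z_polys M \<and>
          rt_inv M * c (2 * n + 2) \<in> z_polys M) \<and>
     (\<forall>k. ms_det (killing M a b c) k = (if k = 2 then scal M (- 4 * complex_of_real (gam M)) else 0)) \<and>
     ms_entries (\<lambda>k. ms_d M (killing M a b c) k + ms_comm (phi_lambda M) (killing M a b c) k)
       \<subseteq> cmc_ideal M"

text \<open>The part of \<open>\<lambda>\<close>-degree at most \<open>-1\<close> of \<open>1/(2i) \<lambda>\<^bsup>-2m-2\<^esup> Y\<close>.\<close>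

definition U_part ::
    "('a :: ring_1, 'b) cmc_data_scheme \<Rightarrow> (nat \<Rightarrow> 'a) \<Rightarrow> (nat \<Rightarrow> 'a) \<Rightarrow> (nat \<Rightarrow> 'a) \<Rightarrow> nat \<Rightarrow> 'a mseries" where
  "U_part M a b c m k =
    (if k \<le> -1
     then map_matrix (\<lambda>x. scal M (1 / (2 * \<i>)) * x) (killing M a b c (k + 2 * int m + 2))
     else 0)"

definition phi_ext ::
    "('a :: {ring_1, topological_ab_group_add, t2_space}, 'b) cmc_data_scheme \<Rightarrow>
       (nat \<Rightarrow> 'a) \<Rightarrow> (nat \<Rightarrow> 'a) \<Rightarrow> (nat \<Rightarrow> 'a) \<Rightarrow> 'a mseries" where
  "phi_ext M a b c k =
     - (\<chi> i j. \<Sum>\<^sub>\<infinity>m\<in>{1..}. ms_adj M (U_part M a b c m) k $ i $ j * ext_d M (fbar M (tim M m)))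
     + phi_lambda M k
     + (\<chi> i j. \<Sum>\<^sub>\<infinity>m\<in>{1..}. U_part M a b c m k $ i $ j * ext_d M (tim M m))"

definition hierarchy_eqs ::
    "('a :: {ring_1, topological_ab_group_add, t2_space}, 'b) cmc_data_scheme \<Rightarrow>
       (nat \<Rightarrow> 'a) \<Rightarrow> (nat \<Rightarrow> 'a) \<Rightarrow> (nat \<Rightarrow> 'a) \<Rightarrow> 'a set" where
  "hierarchy_eqs M a b c = (let
      Y = killing M a b c;
      Y' = (\<lambda>k. - ms_adj M Y k);
      \<Phi> = phi_ext M a b c;
      E = {ext_d M (tim M 0) + scal M (1 / 2) * rt M * xi M,
           ext_d M (xi M) - scal M \<i> * rho M * xi M
             - (\<Sum>\<^sub>\<infinity>m\<in>{1..}. a (2 * m + 3) * ext_d M (tim M m) * xi M),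
           ext_d M (jet M 2) + scal M (2 * \<i>) * jet M 2 * rho M
             - (jet M 3 * xi M - 2 * (\<Sum>\<^sub>\<infinity>m\<in>{1..}. jet M 2 * a (2 * m + 3) * ext_d M (tim M m)))}
    in ms_entries (\<lambda>k. ms_d M Y k + ms_comm \<Phi> Y k) \<union>
       ms_entries (\<lambda>k. ms_d M Y' k + ms_comm \<Phi> Y' k) \<union>
       ms_entries (\<lambda>k. ms_d M \<Phi> k + ms_mult \<Phi> \<Phi> k) \<union>
       E \<union> fbar M ` E)"

definition hierarchy_ideal ::
    "('a :: {ring_1, topological_ab_group_add, t2_space}, 'b) cmc_data_scheme \<Rightarrow>
       (nat \<Rightarrow> 'a) \<Rightarrow> (nat \<Rightarrow> 'a) \<Rightarrow> (nat \<Rightarrow> 'a) \<Rightarrow> 'a set" where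
  "hierarchy_ideal M a b c = diff_ideal_gen M (hierarchy_eqs M a b c)"

text \<open>
  The conservation law is the class of \<open>\<omega>\<close> modulo exact forms and \<open>I\<close>; what a 1-form needs in order
  to represent one is closedness modulo \<open>I\<close>.
\<close>

definition represents_conservation_law ::
    "('a, 'b) form_algebra_scheme \<Rightarrow> 'a set \<Rightarrow> 'a \<Rightarrow> bool" where
  "represents_conservation_law M I \<omega> \<longleftrightarrow> \<omega> \<in> Forms M 1 \<and> ext_d M \<omega> \<in> I"

definition varphi_Y ::
    "('a :: {ring_1, topological_ab_group_add, t2_space}, 'b) cmc_data_scheme \<Rightarrow>
       (nat \<Rightarrow> 'a) \<Rightarrow> (nat \<Rightarrow> 'a) \<Rightarrow> (nat \<Rightarrow> 'a) \<Rightarrow> int \<Rightarrow> 'a" where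
  "varphi_Y M a b c k = trace (ms_mult (killing M a b c) (ms_euler (phi_ext M a b c)) k)"

definition varphi ::
    "('a :: ring_1, 'b) cmc_data_scheme \<Rightarrow> (nat \<Rightarrow> 'a) \<Rightarrow> (nat \<Rightarrow> 'a) \<Rightarrow> nat \<Rightarrow> 'a" where
  "varphi M b c n = c (2 * n + 2) * xi M + b (2 * n) * fbar M (xi M)"

end

theory Submission
  imports Defs
begin

text \<open>
  Write \<open>D\<close> for the Euler operator. The heart of the matter is the identity
  \<open>d tr(Y D\<Phi>) = tr((dY + [\<Phi>, Y]) D\<Phi>) + tr(Y D(d\<Phi> + \<Phi> \<and> \<Phi>))\<close>,
  valid for every matrix series \<open>Y\<close> of 0-forms and every matrix series \<open>\<Phi>\<close> of 1-forms that is
  null in the sense explained below (\<open>d_trace_Killing_euler\<close>). It is formal: \<open>d\<close> and \<open>D\<close> are commuting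
  derivations, and the trace is cyclic up to the sign that 1-forms acquire when they are exchanged,
  so the terms that do not contain \<open>dY\<close> or \<open>d\<Phi>\<close> cancel. For the Killing field \<open>Y\<close> and the
  extended Maurer-Cartan form \<open>\<Phi>\<close> both brackets on the right consist of generators of the ideal of
  the hierarchy, which proves that the coefficients of \<open>tr(Y D\<Phi>)\<close> are closed. Odd powers of
  \<open>\<lambda>\<close> do not occur because \<open>Y\<close> and \<open>\<Phi>\<close> have even powers on the diagonal and odd powers off it.

  What needs care is convergence. The coefficients of \<open>\<Phi>\<close> are infinite sums of \<open>dt\<^sub>m\<close> and their
  conjugates, and \<open>\<Phi>\<close> is infinite in both directions in \<open>\<lambda>\<close>. However, the coefficient of
  \<open>\<lambda>\<^sup>k\<close> in \<open>U\<^sub>m\<close> vanishes for \<open>k < -2m-2\<close>, so only flows with large \<open>m\<close> contribute to the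
  coefficients with large \<open>\<bar>k\<bar>\<close>: modulo the closed ideal generated by the \<open>dt\<^sub>m\<close>, \<open>dtbar\<^sub>m\<close> with
  \<open>m > N\<close>, all but finitely many coefficients of \<open>\<Phi>\<close> vanish. These ideals form a basis of the
  neighbourhoods of \<open>0\<close>. Families of forms that almost vanish in this sense are called null below;
  they can be summed in any order and grouped at will (\<open>infsum_Fubini\<close>). Since a product is null as
  soon as one factor is, a product of two series exists when one of them is null, and a triple
  product is associative when two of the three are null (\<open>conv_assoc\<close>). All products in
  the formal computation above contain enough factors \<open>\<Phi>\<close> for this.

  For the comparison with the CMC system, every flow term lies in the ideal generated by the
  \<open>dt\<^sub>m\<close>, \<open>dtbar\<^sub>m\<close> with \<open>m \<ge> 1\<close>, so modulo that ideal \<open>\<Phi>\<close> may be replaced by \<open>\<phi>\<^sub>\<lambda>\<close>, a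
  Laurent polynomial of three terms. Then \<open>tr(Y D\<phi>\<^sub>\<lambda>)\<close> is an explicit form, and the upper
  left entry of the Killing equation turns \<open>i da\<close> into the form that completes it to
  \<open>-2\<gamma> \<Sum> \<lambda>\<^sup>2\<^sup>n \<phi>\<^sup>n\<close>. That the \<open>\<phi>\<^sup>n\<close> themselves are closed modulo the CMC equations is read
  off from the off-diagonal entries.
\<close>

section \<open>Closed ideals\<close>

lemma closed_ideal_Inter:
  assumes "\<And>J. J \<in> \<J> \<Longrightarrow> closed_ideal J"
  shows "closed_ideal (\<Inter>\<J>)"
  using assms unfolding closed_ideal_def by (auto intro: closed_Inter)

lemma closed_ideal_ideal_gen: "closed_ideal (ideal_gen G)"
  unfolding ideal_gen_def by (rule closed_ideal_Inter) auto

lemma ideal_gen_superset: "G \<subseteq> ideal_gen G"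
  unfolding ideal_gen_def by auto

lemma ideal_gen_mono: "G \<subseteq> H \<Longrightarrow> ideal_gen G \<subseteq> ideal_gen H"
  unfolding ideal_gen_def by auto

lemma closed_ideal_diff_ideal_gen: "closed_ideal (diff_ideal_gen M G)"
  unfolding diff_ideal_gen_def by (rule closed_ideal_Inter) auto

lemma diff_ideal_gen_superset: "G \<subseteq> diff_ideal_gen M G"
  unfolding diff_ideal_gen_def by auto

context
  fixes J :: "'a :: {ring_1, topological_ab_group_add, t2_space} set"
  assumes J: "closed_ideal J"
begin

lemma closed_ideal_zero: "0 \<in> J"
  and closed_ideal_add: "x \<in> J \<Longrightarrow> y \<in> J \<Longrightarrow> x + y \<in> J"
  and closed_ideal_mult_left: "x \<in> J \<Longrightarrow> r * x \<in> J"
  and closed_ideal_mult_right: "x \<in> J \<Longrightarrow> x * r \<in> J"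
  using J unfolding closed_ideal_def by auto

lemma closed_ideal_minus: "x \<in> J \<Longrightarrow> - x \<in> J"
  using closed_ideal_mult_left[of x "-1"] by simp

lemma closed_ideal_diff: "x \<in> J \<Longrightarrow> y \<in> J \<Longrightarrow> x - y \<in> J"
  using closed_ideal_add[of x "- y"] closed_ideal_minus by simp

lemma closed_ideal_sum: "(\<And>x. x \<in> A \<Longrightarrow> f x \<in> J) \<Longrightarrow> sum f A \<in> J"
  by (induction A rule: infinite_finite_induct) (auto intro: closed_ideal_zero closed_ideal_add)

end

text \<open>
  A convergent sum is a limit of finite partial sums; for a divergent family \<open>infsum\<close> takes the
  default value \<open>0\<close>, which also lies in \<open>S\<close>.
\<close>

lemma infsum_in_closed_subset:
  fixes f :: "'i \<Rightarrow> 'a :: {comm_monoid_add, t2_space}"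
  assumes S: "closed S" "0 \<in> S" "\<And>x y. x \<in> S \<Longrightarrow> y \<in> S \<Longrightarrow> x + y \<in> S"
    and f: "\<And>x. x \<in> A \<Longrightarrow> f x \<in> S"
  shows "infsum f A \<in> S"
proof (cases "f summable_on A")
  case True
  have fin: "sum f F \<in> S" if "F \<subseteq> A" for F
    using that by (induction F rule: infinite_finite_induct) (auto intro: S f)
  show ?thesis
  proof (rule Lim_in_closed_set[OF S(1)])
    show "\<forall>\<^sub>F F in finite_subsets_at_top A. sum f F \<in> S"
      by (rule eventually_finite_subsets_at_top_weakI) (rule fin)
    show "(sum f \<longlongrightarrow> infsum f A) (finite_subsets_at_top A)"
      using True by (metis has_sum_def has_sum_infsum)
  qed simp
next
  case False
  then show ?thesis by (simp add: infsum_not_exists S(2))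
qed

lemma infsum_in_closed_ideal:
  fixes J :: "'a :: {ring_1, topological_ab_group_add, t2_space} set"
  assumes "closed_ideal J" "\<And>x. x \<in> A \<Longrightarrow> f x \<in> J"
  shows "infsum f A \<in> J"
  using assms by (intro infsum_in_closed_subset) (auto simp: closed_ideal_def)

section \<open>Computation rules for differential forms\<close>

context form_algebra
begin

lemma scal_zero: "scal M 0 = 0"
  using scal_add[of 0 0] by simp

lemma scal_uminus: "scal M (- z) = - scal M z"
  using scal_add[of z "- z"] by (simp add: scal_zero eq_neg_iff_add_eq_0 add.commute)

lemma scal_of_int: "scal M (of_int k) = of_int k"
proof -
  have nat: "scal M (of_nat n) = of_nat n" for n
    by (induction n) (auto simp: scal_zero scal_one scal_add)
  show ?thesis by (cases k) (auto simp: nat scal_uminus simp del: of_nat_Suc)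
qed

lemma scal_numeral: "scal M (numeral n) = numeral n"
  using scal_of_int[of "numeral n"] by simp

lemma Forms_scal_mult: "x \<in> Forms M p \<Longrightarrow> scal M z * x \<in> Forms M p"
  using Forms_mult[OF scal_Forms] by force

lemma Forms_of_int_mult: "x \<in> Forms M p \<Longrightarrow> of_int k * x \<in> Forms M p"
  using Forms_scal_mult[of x p "of_int k"] by (simp add: scal_of_int)

lemma Forms_uminus: "x \<in> Forms M p \<Longrightarrow> - x \<in> Forms M p"
  using Forms_of_int_mult[of x p "-1"] by simp

lemma Forms_diff: "x \<in> Forms M p \<Longrightarrow> y \<in> Forms M p \<Longrightarrow> x - y \<in> Forms M p"
  using Forms_add[of x p "- y"] Forms_uminus by simp

lemma Forms_sum: "(\<And>x. x \<in> A \<Longrightarrow> f x \<in> Forms M p) \<Longrightarrow> sum f A \<in> Forms M p"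
  by (induction A rule: infinite_finite_induct) (auto intro: Forms_zero Forms_add)

lemma Forms_infsum: "(\<And>x. x \<in> A \<Longrightarrow> f x \<in> Forms M p) \<Longrightarrow> infsum f A \<in> Forms M p"
  by (intro infsum_in_closed_subset Forms_closed Forms_zero Forms_add)

lemma Forms_mult_0: "x \<in> Forms M 0 \<Longrightarrow> y \<in> Forms M p \<Longrightarrow> x * y \<in> Forms M p"
  using Forms_mult by force

lemma Forms_double: "x \<in> Forms M p \<Longrightarrow> 2 * x \<in> Forms M p"
  using Forms_scal_mult[of x p 2] by (simp add: scal_numeral)

lemma Forms_power: "x \<in> Forms M 0 \<Longrightarrow> x ^ n \<in> Forms M 0"
  by (induction n) (use scal_Forms[of 1] in \<open>auto simp: scal_one intro: Forms_mult_0\<close>)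

lemma d_zero: "ext_d M 0 = 0"
  using d_add[of 0 0] by simp

lemma d_uminus: "ext_d M (- x) = - ext_d M x"
  using d_add[of x "- x"] by (simp add: d_zero eq_neg_iff_add_eq_0 add.commute)

lemma d_sum: "ext_d M (sum f A) = (\<Sum>x\<in>A. ext_d M (f x))"
  by (induction A rule: infinite_finite_induct) (auto simp: d_zero d_add)

lemma d_scal_mult: "ext_d M (scal M z * x) = scal M z * ext_d M x"
  using d_Leibniz[OF scal_Forms, of z x] by (simp add: d_scal)

lemma d_of_int_mult: "ext_d M (of_int k * x) = of_int k * ext_d M x"
  using d_scal_mult[of "of_int k" x] by (simp add: scal_of_int)

lemma d_infsum:
  assumes "f summable_on A"
  shows "ext_d M (infsum f A) = (\<Sum>\<^sub>\<infinity>x\<in>A. ext_d M (f x))"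
    and "(\<lambda>x. ext_d M (f x)) summable_on A"
proof -
  have "Modules.additive (ext_d M)"
    by unfold_locales (rule d_add)
  moreover have "isCont (ext_d M) x" for x
    using d_continuous by (simp add: continuous_on_eq_continuous_at)
  ultimately show "ext_d M (infsum f A) = (\<Sum>\<^sub>\<infinity>x\<in>A. ext_d M (f x))"
    and "(\<lambda>x. ext_d M (f x)) summable_on A"
    using infsum_comm_additive[of "ext_d M" f A] summable_on_comm_additive[of "ext_d M" f A] assms
    by (simp_all add: o_def)
qed

lemma bar_zero: "fbar M 0 = 0"
  using bar_add[of 0 0] by simp

lemma bar_uminus: "fbar M (- x) = - fbar M x"
  using bar_add[of x "- x"] by (simp add: bar_zero eq_neg_iff_add_eq_0 add.commute)

lemma bar_diff: "fbar M (x - y) = fbar M x - fbar M y"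
  using bar_add[of x "- y"] by (simp add: bar_uminus)

lemma zero_form_commute: "x \<in> Forms M 0 \<Longrightarrow> y \<in> Forms M p \<Longrightarrow> x * y = y * x"
  using graded_comm[of x 0 y p] by simp

lemma zero_form_scal: "x \<in> Forms M 0 \<Longrightarrow> x * scal M s = scal M s * x"
  "x \<in> Forms M 0 \<Longrightarrow> x * (scal M s * y) = scal M s * (x * y)"
proof -
  show *: "x * scal M s = scal M s * x" if "x \<in> Forms M 0" for x
    using zero_form_commute[OF that scal_Forms] .
  show "x * (scal M s * y) = scal M s * (x * y)" if "x \<in> Forms M 0"
    using *[OF that] by (metis mult.assoc)
qed

lemma scal_scal: "scal M s * (scal M t * x) = scal M (s * t) * x"
  by (simp add: scal_mult mult.assoc)

lemma zero_form_left_commute: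
  "u \<in> Forms M 0 \<Longrightarrow> v \<in> Forms M 0 \<Longrightarrow> u * (v * x) = v * (u * x)"
  using zero_form_commute by (metis mult.assoc)

lemma double_eq_scal: "2 * x = scal M 2 * x"
  by (simp add: scal_numeral)

lemma one_forms_anticommute: "x \<in> Forms M 1 \<Longrightarrow> y \<in> Forms M 1 \<Longrightarrow> x * y = - (y * x)"
  using graded_comm[of x 1 y 1] by simp

lemma one_form_square:
  assumes "x \<in> Forms M 1"
  shows "x * x = 0"
proof -
  have "x * x + x * x = 0"
    using one_forms_anticommute[OF assms assms] by (simp add: eq_neg_iff_add_eq_0)
  then have "scal M (1/2) * (x * x) + scal M (1/2) * (x * x) = 0"
    by (simp flip: distrib_left)
  then have "scal M (1/2 + 1/2) * (x * x) = 0"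
    unfolding scal_add distrib_right .
  then show ?thesis by (simp add: scal_one)
qed

end

section \<open>Summation of null families\<close>

context cmc_forms
begin

abbreviation tail_ideal :: "nat \<Rightarrow> 'a set" where
  "tail_ideal N \<equiv> ideal_gen (dt_beyond M N)"

text \<open>
  The space is Hausdorff and the tail ideals form a neighbourhood basis of \<open>0\<close>, so they meet in
  \<open>0\<close> only. Identities between infinite sums thereby reduce to identities between finite ones.
\<close>

lemma eq_modulo_tail_ideals:
  assumes "\<And>N. x - y \<in> tail_ideal N"
  shows "x = y"
proof (rule ccontr)
  assume "x \<noteq> y"
  then have "open (- {x - y})" "0 \<in> - {x - y}" by auto
  then have "eventually (\<lambda>z. z \<in> - {x - y}) (nhds 0)"
    by (rule eventually_nhds_in_open)
  then show False using assms unfolding topology by blast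
qed

text \<open>
  Convergence to \<open>0\<close> along the cofinite filter, for the linear topology of the tail ideals.
\<close>

definition null_family :: "('i \<Rightarrow> 'a) \<Rightarrow> bool" where
  "null_family f \<longleftrightarrow> (\<forall>N. finite {x. f x \<notin> tail_ideal N})"

definition homogeneous :: "nat \<Rightarrow> ('i \<Rightarrow> 'a) \<Rightarrow> bool" where
  "homogeneous p f \<longleftrightarrow> (\<forall>x. f x \<in> Forms M p)"

text \<open>
  Completeness speaks of sequences; an enumeration of the index set transports it to any countable
  index set.
\<close>

lemma null_family_summable:
  fixes f :: "'i :: countable \<Rightarrow> 'a"
  assumes "null_family f" "homogeneous p f"
  shows "f summable_on UNIV"
proof (cases "finite (UNIV :: 'i set)")
  case False
  define e :: "nat \<Rightarrow> 'i" where "e = from_nat_into UNIV"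
  have e: "bij e"
    unfolding e_def using False by (intro bij_betw_from_nat_into) auto
  have "(\<lambda>n. f (e n)) \<longlonglongrightarrow> 0"
    unfolding filterlim_iff topology
  proof (intro allI impI, elim exE)
    fix P N assume P: "\<forall>x\<in>tail_ideal N. P x"
    have "finite {x. f x \<notin> tail_ideal N}"
      using assms by (simp add: null_family_def)
    then have "finite (e -` {x. f x \<notin> tail_ideal N})"
      by (rule finite_vimageI) (use e in \<open>simp add: bij_is_inj\<close>)
    then have "\<forall>\<^sub>F n in cofinite. f (e n) \<in> tail_ideal N"
      unfolding eventually_cofinite vimage_def mem_Collect_eq .
    then show "\<forall>\<^sub>F n in sequentially. P (f (e n))"
      unfolding cofinite_eq_sequentially by (rule eventually_mono) (use P in blast)
  qed
  then have "(\<lambda>n. f (e n)) summable_on UNIV"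
    using assms by (intro complete) (auto simp: homogeneous_def)
  then show ?thesis
    by (subst (asm) summable_on_reindex_bij_betw[OF e]) 
qed simp

lemma infsum_modulo_tail_ideal:
  fixes f :: "'i :: countable \<Rightarrow> 'a"
  assumes f: "null_family f" "homogeneous p f"
    and F: "finite F" "\<And>x. x \<notin> F \<Longrightarrow> f x \<in> tail_ideal N"
  shows "infsum f UNIV - sum f F \<in> tail_ideal N"
proof -
  have "f summable_on (UNIV - F)"
    using null_family_summable[OF f] F(1) by (rule summable_on_cofin_subset)
  then have "infsum f (F \<union> (UNIV - F)) = infsum f F + infsum f (UNIV - F)"
    using F(1) by (intro infsum_Un_disjoint) auto
  moreover have "infsum f (UNIV - F) \<in> tail_ideal N"
    using F(2) by (intro infsum_in_closed_ideal closed_ideal_ideal_gen) auto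
  ultimately show ?thesis using F(1) by simp
qed

lemma null_family_row:
  assumes "null_family f"
  shows "null_family (\<lambda>y. f (x, y))"
  unfolding null_family_def
proof
  fix N
  have "finite (Pair x -` {q. f q \<notin> tail_ideal N})"
    using assms by (intro finite_vimageI) (auto simp: null_family_def inj_on_def)
  then show "finite {y. f (x, y) \<notin> tail_ideal N}" by (simp add: vimage_def)
qed

lemma homogeneous_row: "homogeneous p f \<Longrightarrow> homogeneous p (\<lambda>y. f (x, y))"
  by (simp add: homogeneous_def)

lemma null_family_infsum_rows:
  assumes "null_family f"
  shows "null_family (\<lambda>x. \<Sum>\<^sub>\<infinity>y. f (x, y))"
  unfolding null_family_def
proof
  fix N
  let ?F = "{q. f q \<notin> tail_ideal N}"
  have "(\<Sum>\<^sub>\<infinity>y. f (x, y)) \<in> tail_ideal N" if "x \<notin> fst ` ?F" for x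
    using that by (intro infsum_in_closed_ideal closed_ideal_ideal_gen) force
  then have "{x. (\<Sum>\<^sub>\<infinity>y. f (x, y)) \<notin> tail_ideal N} \<subseteq> fst ` ?F" by blast
  moreover have "finite ?F" using assms by (simp add: null_family_def)
  ultimately show "finite {x. (\<Sum>\<^sub>\<infinity>y. f (x, y)) \<notin> tail_ideal N}"
    by (meson finite_imageI finite_subset)
qed

lemma homogeneous_infsum_rows:
  "homogeneous p f \<Longrightarrow> homogeneous p (\<lambda>x. \<Sum>\<^sub>\<infinity>y. f (x, y))"
  by (simp add: homogeneous_def Forms_infsum)

text \<open>
  Modulo a tail ideal all but finitely many terms vanish, and both sides become the same sum over a
  finite rectangle.
\<close>

lemma infsum_Fubini:
  fixes f :: "'i :: countable \<times> 'j :: countable \<Rightarrow> 'a"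
  assumes f: "null_family f" "homogeneous p f"
  shows "(\<Sum>\<^sub>\<infinity>x. \<Sum>\<^sub>\<infinity>y. f (x, y)) = infsum f UNIV"
proof (rule eq_modulo_tail_ideals)
  fix N
  note ideal = closed_ideal_ideal_gen[of "dt_beyond M N"]
  let ?F = "{q. f q \<notin> tail_ideal N}"
  define A B where "A = fst ` ?F" and "B = snd ` ?F"
  have fin: "finite A" "finite B"
    using f(1) by (auto simp: A_def B_def null_family_def)
  have out: "f (x, y) \<in> tail_ideal N" if "x \<notin> A \<or> y \<notin> B" for x y
    using that by (force simp: A_def B_def)
  have rows: "(\<Sum>\<^sub>\<infinity>y. f (x, y)) - (\<Sum>y\<in>B. f (x, y)) \<in> tail_ideal N" for x
    using null_family_row[OF f(1)] homogeneous_row[OF f(2)] fin out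
    by (intro infsum_modulo_tail_ideal) auto
  have "(\<Sum>\<^sub>\<infinity>x. \<Sum>\<^sub>\<infinity>y. f (x, y)) - (\<Sum>x\<in>A. \<Sum>\<^sub>\<infinity>y. f (x, y)) \<in> tail_ideal N"
    using null_family_infsum_rows[OF f(1)] homogeneous_infsum_rows[OF f(2)] fin out
    by (intro infsum_modulo_tail_ideal infsum_in_closed_ideal ideal) auto
  moreover have "(\<Sum>x\<in>A. (\<Sum>\<^sub>\<infinity>y. f (x, y)) - (\<Sum>y\<in>B. f (x, y))) \<in> tail_ideal N"
    by (intro closed_ideal_sum ideal rows)
  moreover have "infsum f UNIV - (\<Sum>q\<in>A \<times> B. f q) \<in> tail_ideal N"
    using f fin out by (intro infsum_modulo_tail_ideal) auto
  moreover have "(\<Sum>q\<in>A \<times> B. f q) = (\<Sum>x\<in>A. \<Sum>y\<in>B. f (x, y))"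
    by (simp add: sum.cartesian_product)
  ultimately have "((\<Sum>\<^sub>\<infinity>x. \<Sum>\<^sub>\<infinity>y. f (x, y)) - (\<Sum>x\<in>A. \<Sum>\<^sub>\<infinity>y. f (x, y)))
      + ((\<Sum>x\<in>A. (\<Sum>\<^sub>\<infinity>y. f (x, y)) - (\<Sum>y\<in>B. f (x, y)))
      - (infsum f UNIV - (\<Sum>x\<in>A. \<Sum>y\<in>B. f (x, y)))) \<in> tail_ideal N"
    by (simp only: closed_ideal_add[OF ideal] closed_ideal_diff[OF ideal])
  then show "(\<Sum>\<^sub>\<infinity>x. \<Sum>\<^sub>\<infinity>y. f (x, y)) - infsum f UNIV \<in> tail_ideal N"
    by (simp add: sum_subtractf algebra_simps)
qed

lemma tail_ideal_mult: "x \<in> tail_ideal N \<or> y \<in> tail_ideal N \<Longrightarrow> x * y \<in> tail_ideal N"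
  using closed_ideal_mult_left[OF closed_ideal_ideal_gen] closed_ideal_mult_right[OF closed_ideal_ideal_gen]
  by blast

lemma null_familyI:
  assumes "\<And>N. \<exists>F. finite F \<and> (\<forall>x. x \<notin> F \<longrightarrow> f x \<in> tail_ideal N)"
  shows "null_family f"
  unfolding null_family_def
proof
  fix N
  obtain F where "finite F" "\<forall>x. x \<notin> F \<longrightarrow> f x \<in> tail_ideal N" using assms by blast
  then show "finite {x. f x \<notin> tail_ideal N}" by (auto intro: rev_finite_subset)
qed

lemma null_family_compose:
  assumes "null_family f" "inj \<beta>"
  shows "null_family (f \<circ> \<beta>)"
  unfolding null_family_def
proof
  fix N
  have "finite (\<beta> -` {x. f x \<notin> tail_ideal N})"
    using assms by (intro finite_vimageI) (auto simp: null_family_def)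
  then show "finite {x. (f \<circ> \<beta>) x \<notin> tail_ideal N}" by (simp add: vimage_def)
qed

lemma null_family_add:
  assumes "null_family f" "null_family g"
  shows "null_family (\<lambda>x. f x + g x)"
proof (rule null_familyI)
  fix N
  show "\<exists>F. finite F \<and> (\<forall>x. x \<notin> F \<longrightarrow> f x + g x \<in> tail_ideal N)"
    using assms unfolding null_family_def
    by (intro exI[of _ "{x. f x \<notin> tail_ideal N} \<union> {x. g x \<notin> tail_ideal N}"])
       (auto intro: closed_ideal_add[OF closed_ideal_ideal_gen])
qed

lemma null_family_sum:
  "finite A \<Longrightarrow> (\<And>l. l \<in> A \<Longrightarrow> null_family (f l)) \<Longrightarrow> null_family (\<lambda>x. \<Sum>l\<in>A. f l x)"
proof (induction A rule: finite_induct)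
  case empty
  then show ?case
    by (auto simp: null_family_def closed_ideal_zero[OF closed_ideal_ideal_gen])
next
  case (insert l A)
  then show ?case by (auto intro: null_family_add)
qed

lemma null_family_mult: "null_family g \<Longrightarrow> null_family (\<lambda>x. f x * g x)"
  unfolding null_family_def
  using tail_ideal_mult by (metis (mono_tags, lifting) Collect_mono_iff finite_subset)

text \<open>
  Continuity of \<open>d\<close> at \<open>0\<close> says precisely that \<open>d\<close> maps some tail ideal into any given one.
\<close>

lemma null_family_d:
  assumes "null_family f"
  shows "null_family (\<lambda>x. ext_d M (f x))"
proof (rule null_familyI)
  fix N
  have "(ext_d M \<longlongrightarrow> ext_d M 0) (nhds 0)"
    using d_continuous
    by (simp add: continuous_on_eq_continuous_at isCont_def tendsto_at_iff_tendsto_nhds)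
  moreover have "\<forall>\<^sub>F x in nhds 0. x \<in> tail_ideal N"
    unfolding topology by blast
  ultimately have "\<forall>\<^sub>F x in nhds 0. ext_d M x \<in> tail_ideal N"
    unfolding d_zero by (rule eventually_compose_filterlim[rotated])
  then obtain N' where N': "\<forall>x\<in>tail_ideal N'. ext_d M x \<in> tail_ideal N"
    unfolding topology by blast
  show "\<exists>F. finite F \<and> (\<forall>x. x \<notin> F \<longrightarrow> ext_d M (f x) \<in> tail_ideal N)"
    using assms N' unfolding null_family_def
    by (intro exI[of _ "{x. f x \<notin> tail_ideal N'}"]) auto
qed

section \<open>Convolution of formal series\<close>

definition conv :: "(int \<Rightarrow> 'a) \<Rightarrow> (int \<Rightarrow> 'a) \<Rightarrow> int \<Rightarrow> 'a" where
  "conv f g k = (\<Sum>\<^sub>\<infinity>n. f n * g (k - n))"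

lemma null_family_conv_terms:
  fixes f g :: "int \<Rightarrow> 'a"
  assumes "null_family f \<or> null_family g"
  shows "null_family (\<lambda>n. f n * g (k - n))"
proof (rule null_familyI)
  fix N
  let ?F = "{n. f n \<notin> tail_ideal N}" and ?G = "(\<lambda>n. k - n) ` {n. g n \<notin> tail_ideal N}"
  have out: "f n * g (k - n) \<in> tail_ideal N" if "n \<notin> ?F \<or> n \<notin> ?G" for n
  proof (rule tail_ideal_mult, rule ccontr)
    assume "\<not> (f n \<in> tail_ideal N \<or> g (k - n) \<in> tail_ideal N)"
    moreover from this have "n \<in> ?G" by (intro image_eqI[of _ _ "k - n"]) auto
    ultimately show False using that by blast
  qed
  show "\<exists>F. finite F \<and> (\<forall>n. n \<notin> F \<longrightarrow> f n * g (k - n) \<in> tail_ideal N)"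
  proof (cases "null_family f")
    case True
    then have "finite ?F" by (simp add: null_family_def)
    then show ?thesis using out by blast
  next
    case False
    then have "null_family g" using assms by blast
    then have "finite ?G" by (simp add: null_family_def)
    then show ?thesis using out by blast
  qed
qed

lemma homogeneous_conv_terms:
  fixes f g :: "int \<Rightarrow> 'a"
  shows
  "homogeneous p f \<Longrightarrow> homogeneous q g \<Longrightarrow> homogeneous (p + q) (\<lambda>n. f n * g (k - n))"
  by (simp add: homogeneous_def Forms_mult)

lemma conv_summable:
  fixes f g :: "int \<Rightarrow> 'a"
  assumes "homogeneous p f" "homogeneous q g" "null_family f \<or> null_family g"
  shows "(\<lambda>n. f n * g (k - n)) summable_on UNIV"
  by (rule null_family_summable[where p = "p + q"])
     (rule null_family_conv_terms[OF assms(3)], rule homogeneous_conv_terms[OF assms(1,2)])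

lemma homogeneous_conv:
  assumes "homogeneous p f" "homogeneous q g"
  shows "homogeneous (p + q) (conv f g)"
  using homogeneous_conv_terms[OF assms]
  by (auto simp: homogeneous_def conv_def intro: Forms_infsum)

lemma null_family_conv:
  assumes "null_family f" "null_family g"
  shows "null_family (conv f g)"
proof -
  have "null_family (\<lambda>(k, n). f n * g (k - n))"
  proof (rule null_familyI)
    fix N
    let ?F = "{n. f n \<notin> tail_ideal N}" and ?G = "{n. g n \<notin> tail_ideal N}"
    have "finite ((\<lambda>(n, l). (n + l, n)) ` (?F \<times> ?G))"
      using assms by (simp add: null_family_def)
    moreover have "f n * g (k - n) \<in> tail_ideal N"
      if "(k, n) \<notin> (\<lambda>(n, l). (n + l, n)) ` (?F \<times> ?G)" for k n
    proof (rule tail_ideal_mult, rule ccontr)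
      assume "\<not> (f n \<in> tail_ideal N \<or> g (k - n) \<in> tail_ideal N)"
      then have "(n, k - n) \<in> ?F \<times> ?G" by simp
      then show False using that by force
    qed
    ultimately show "\<exists>F. finite F \<and> (\<forall>x. x \<notin> F \<longrightarrow> (case x of (k, n) \<Rightarrow> f n * g (k - n)) \<in> tail_ideal N)"
      by (intro exI[of _ "(\<lambda>(n, l). (n + l, n)) ` (?F \<times> ?G)"]) auto
  qed
  from null_family_infsum_rows[OF this] show ?thesis by (simp add: conv_def[abs_def])
qed

lemma conv_add_left:
  assumes "homogeneous p f" "homogeneous p f'" "homogeneous q g" "null_family f \<and> null_family f' \<or> null_family g"
  shows "conv (\<lambda>n. f n + f' n) g k = conv f g k + conv f' g k"
  unfolding conv_def distrib_right using assms by (intro infsum_add conv_summable) auto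

lemma conv_add_right:
  assumes "homogeneous p f" "homogeneous q g" "homogeneous q g'" "null_family f \<or> null_family g \<and> null_family g'"
  shows "conv f (\<lambda>n. g n + g' n) k = conv f g k + conv f g' k"
  unfolding conv_def distrib_left using assms by (intro infsum_add conv_summable) auto

lemma homogeneous_sum: "(\<And>l. l \<in> A \<Longrightarrow> homogeneous p (f l)) \<Longrightarrow> homogeneous p (\<lambda>n. \<Sum>l\<in>A. f l n)"
  by (simp add: homogeneous_def Forms_sum)

lemma conv_sum_left:
  assumes "finite A" "\<And>l. l \<in> A \<Longrightarrow> homogeneous p (f l)" "homogeneous q g"
    "(\<forall>l\<in>A. null_family (f l)) \<or> null_family g"
  shows "conv (\<lambda>n. \<Sum>l\<in>A. f l n) g k = (\<Sum>l\<in>A. conv (f l) g k)"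
  using assms
proof (induction A rule: finite_induct)
  case empty
  then show ?case by (simp add: conv_def)
next
  case (insert l A)
  have "conv (\<lambda>n. f l n + (\<Sum>l\<in>A. f l n)) g k = conv (f l) g k + conv (\<lambda>n. \<Sum>l\<in>A. f l n) g k"
    using insert.prems insert.hyps by (intro conv_add_left homogeneous_sum) (auto intro: null_family_sum)
  then show ?case using insert by auto
qed

lemma conv_sum_right:
  assumes "finite A" "\<And>l. l \<in> A \<Longrightarrow> homogeneous q (g l)" "homogeneous p f"
    "null_family f \<or> (\<forall>l\<in>A. null_family (g l))"
  shows "conv f (\<lambda>n. \<Sum>l\<in>A. g l n) k = (\<Sum>l\<in>A. conv f (g l) k)"
  using assms
proof (induction A rule: finite_induct)
  case empty
  then show ?case by (simp add: conv_def)
next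
  case (insert l A)
  have "conv f (\<lambda>n. g l n + (\<Sum>l\<in>A. g l n)) k = conv f (g l) k + conv f (\<lambda>n. \<Sum>l\<in>A. g l n) k"
    using insert.prems insert.hyps by (intro conv_add_right homogeneous_sum) (auto intro: null_family_sum)
  then show ?case using insert by auto
qed

text \<open>
  Both sides are sums of the terms \<open>f m * g l * h (k - m - l)\<close> over all \<open>(m, l)\<close>. Any two of the
  exponents \<open>m\<close>, \<open>l\<close>, \<open>k - m - l\<close> determine the third, so if two of the series are null then only
  finitely many terms survive modulo a tail ideal.
\<close>

lemma conv_assoc:
  assumes hom: "homogeneous p f" "homogeneous q g" "homogeneous r h"
    and null: "null_family f \<and> null_family g \<or> null_family f \<and> null_family h \<or> null_family g \<and> null_family h"
  shows "conv (conv f g) h k = conv f (conv g h) k"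
proof -
  define G where "G = (\<lambda>(m, l). f m * g l * h (k - m - l))"
  have G_null: "null_family G"
  proof (rule null_familyI)
    fix N
    let ?f = "{n. f n \<notin> tail_ideal N}" and ?g = "{n. g n \<notin> tail_ideal N}"
      and ?h = "{n. h n \<notin> tail_ideal N}"
    let ?S = "{(m, l). m \<in> ?f \<and> l \<in> ?g \<and> k - m - l \<in> ?h}"
    have "finite ?S"
    proof -
      have "?S \<subseteq> ?f \<times> ?g" by auto
      moreover have "?S \<subseteq> (\<lambda>(m, n). (m, k - m - n)) ` (?f \<times> ?h)"
      proof clarify
        fix m l assume "f m \<notin> tail_ideal N" "h (k - m - l) \<notin> tail_ideal N"
        then show "(m, l) \<in> (\<lambda>(m, n). (m, k - m - n)) ` (?f \<times> ?h)"
          by (intro image_eqI[of _ _ "(m, k - m - l)"]) auto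
      qed
      moreover have "?S \<subseteq> (\<lambda>(l, n). (k - l - n, l)) ` (?g \<times> ?h)"
      proof clarify
        fix m l assume "g l \<notin> tail_ideal N" "h (k - m - l) \<notin> tail_ideal N"
        then show "(m, l) \<in> (\<lambda>(l, n). (k - l - n, l)) ` (?g \<times> ?h)"
          by (intro image_eqI[of _ _ "(l, k - m - l)"]) auto
      qed
      ultimately show ?thesis
        using null unfolding null_family_def by (meson finite_SigmaI finite_imageI finite_subset)
    qed
    moreover have "G x \<in> tail_ideal N" if "x \<notin> ?S" for x
      using that by (auto simp: G_def intro!: tail_ideal_mult)
    ultimately show "\<exists>F. finite F \<and> (\<forall>x. x \<notin> F \<longrightarrow> G x \<in> tail_ideal N)" by blast
  qed
  have G_hom: "homogeneous (p + q + r) G"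
    using hom by (auto simp: homogeneous_def G_def intro!: Forms_mult)
  \<comment> \<open>The left-hand side is summed over \<open>n = m + l\<close> and \<open>m\<close>, the right-hand side over \<open>m\<close> and \<open>l\<close>.\<close>
  define \<beta> where "\<beta> = (\<lambda>(n, m). (m :: int, n - m :: int))"
  have \<beta>: "bij \<beta>"
    by (rule bij_betw_byWitness[where f' = "\<lambda>(m, l). (m + l, m)"]) (auto simp: \<beta>_def)
  have F_null: "null_family (G \<circ> \<beta>)"
    using G_null \<beta> by (intro null_family_compose bij_is_inj)
  have F_hom: "homogeneous (p + q + r) (G \<circ> \<beta>)"
    using G_hom unfolding homogeneous_def o_def by blast
  have "conv (conv f g) h k = (\<Sum>\<^sub>\<infinity>n. \<Sum>\<^sub>\<infinity>m. (G \<circ> \<beta>) (n, m))"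
  proof -
    have "conv f g n * h (k - n) = (\<Sum>\<^sub>\<infinity>m. (G \<circ> \<beta>) (n, m))" for n
      using hom null conv_summable[of p f q g n]
      unfolding conv_def G_def \<beta>_def by (subst infsum_cmult_left[symmetric]) auto
    then show ?thesis by (simp add: conv_def[of "conv f g"])
  qed
  also have "\<dots> = infsum (G \<circ> \<beta>) UNIV"
    by (rule infsum_Fubini[OF F_null F_hom])
  also have "\<dots> = infsum G UNIV"
    using infsum_reindex_bij_betw[OF \<beta>, of G] by (simp add: o_def)
  also have "\<dots> = (\<Sum>\<^sub>\<infinity>m. \<Sum>\<^sub>\<infinity>l. G (m, l))"
    by (rule infsum_Fubini[OF G_null G_hom, symmetric])
  also have "\<dots> = conv f (conv g h) k"
  proof -
    have "f m * conv g h (k - m) = (\<Sum>\<^sub>\<infinity>l. G (m, l))" for m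
      using hom null conv_summable[of q g r h "k - m"]
      unfolding conv_def G_def by (subst infsum_cmult_right[symmetric]) (auto simp: mult.assoc)
    then show ?thesis by (simp add: conv_def[of f])
  qed
  finally show ?thesis .
qed

lemma conv_anticommute:
  assumes "homogeneous 1 f" "homogeneous 1 g"
  shows "conv f g k = - conv g f k"
proof -
  have "conv f g k = (\<Sum>\<^sub>\<infinity>n. - (g (k - n) * f (k - (k - n))))"
    unfolding conv_def
  proof (rule infsum_cong)
    fix n
    have "f n * g (k - n) = - (g (k - n) * f n)"
      using assms by (intro one_forms_anticommute) (auto simp: homogeneous_def)
    then show "f n * g (k - n) = - (g (k - n) * f (k - (k - n)))" by simp
  qed
  also have "\<dots> = - (\<Sum>\<^sub>\<infinity>n. g (k - n) * f (k - (k - n)))"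
    by (rule infsum_uminus)
  also have "(\<Sum>\<^sub>\<infinity>n. g (k - n) * f (k - (k - n))) = conv g f k"
    unfolding conv_def
    by (rule infsum_reindex_bij_betw[of "\<lambda>n. k - n"])
       (rule bij_betw_byWitness[where f' = "\<lambda>n. k - n"]; simp)
  finally show ?thesis .
qed

lemma homogeneous_euler: "homogeneous p f \<Longrightarrow> homogeneous p (\<lambda>n. of_int n * f n)"
  by (simp add: homogeneous_def Forms_of_int_mult)

lemma conv_euler:
  assumes "homogeneous p f" "homogeneous q g" "null_family f \<or> null_family g"
  shows "of_int k * conv f g k = conv (\<lambda>n. of_int n * f n) g k + conv f (\<lambda>n. of_int n * g n) k"
proof -
  have "of_int k * conv f g k = (\<Sum>\<^sub>\<infinity>n. of_int k * (f n * g (k - n)))"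
    unfolding conv_def by (intro infsum_cmult_right[symmetric] conv_summable[OF assms])
  also have "\<dots> = (\<Sum>\<^sub>\<infinity>n. of_int n * f n * g (k - n) + f n * (of_int (k - n) * g (k - n)))"
  proof (rule infsum_cong)
    fix n
    have "f n * (of_int (k - n) * g (k - n)) = of_int (k - n) * (f n * g (k - n))"
      using mult_of_int_commute[of "k - n" "f n"] by (simp only: mult.assoc[symmetric])
    then show "of_int k * (f n * g (k - n))
        = of_int n * f n * g (k - n) + f n * (of_int (k - n) * g (k - n))"
      by (simp add: algebra_simps)
  qed
  also have "\<dots> = conv (\<lambda>n. of_int n * f n) g k + conv f (\<lambda>n. of_int n * g n) k"
    unfolding conv_def using assms null_family_mult[of f of_int] null_family_mult[of g of_int]
    by (intro infsum_add conv_summable[of p _ q] homogeneous_euler) auto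
  finally show ?thesis .
qed

lemma conv_d:
  assumes "homogeneous 0 f" "homogeneous q g" "null_family f \<or> null_family g"
  shows "ext_d M (conv f g k) = conv (\<lambda>n. ext_d M (f n)) g k + conv f (\<lambda>n. ext_d M (g n)) k"
proof -
  have "ext_d M (conv f g k) = (\<Sum>\<^sub>\<infinity>n. ext_d M (f n * g (k - n)))"
    unfolding conv_def by (intro d_infsum(1) conv_summable[OF assms])
  also have "\<dots> = (\<Sum>\<^sub>\<infinity>n. ext_d M (f n) * g (k - n) + f n * ext_d M (g (k - n)))"
    using assms(1) d_Leibniz[of _ 0] by (simp add: homogeneous_def)
  also have "\<dots> = conv (\<lambda>n. ext_d M (f n)) g k + conv f (\<lambda>n. ext_d M (g n)) k"
    unfolding conv_def
  proof (rule infsum_add)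
    have "homogeneous 1 (\<lambda>n. ext_d M (f n))" "homogeneous (Suc q) (\<lambda>n. ext_d M (g n))"
      using assms d_Forms[of _ 0] d_Forms by (auto simp: homogeneous_def)
    then show "(\<lambda>n. ext_d M (f n) * g (k - n)) summable_on UNIV"
      and "(\<lambda>n. f n * ext_d M (g (k - n))) summable_on UNIV"
      using assms null_family_d[of f] null_family_d[of g]
      by (auto intro: conv_summable[of _ _ _ g] conv_summable[of _ f])
  qed
  finally show ?thesis .
qed

lemma conv_eq_zero: "(\<And>n. f n * g (k - n) = 0) \<Longrightarrow> conv f g k = 0"
  by (simp add: conv_def)

lemma conv_commute_zero_forms:
  assumes "homogeneous 0 f" "homogeneous p g"
  shows "conv f g k = conv g f k"
proof -
  have "conv f g k = (\<Sum>\<^sub>\<infinity>n. g (k - n) * f (k - (k - n)))"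
    unfolding conv_def
  proof (rule infsum_cong)
    fix n
    have "f n * g (k - n) = g (k - n) * f n"
      using assms by (intro zero_form_commute) (auto simp: homogeneous_def)
    then show "f n * g (k - n) = g (k - n) * f (k - (k - n))" by simp
  qed
  also have "\<dots> = conv g f k"
    unfolding conv_def
    by (rule infsum_reindex_bij_betw[of "\<lambda>n. k - n"])
       (rule bij_betw_byWitness[where f' = "\<lambda>n. k - n"]; simp)
  finally show ?thesis .
qed

lemma conv_uminus: "conv (\<lambda>n. - f n) g k = - conv f g k" "conv f (\<lambda>n. - g n) k = - conv f g k"
  by (simp_all add: conv_def infsum_uminus)

lemma conv_supported_at_0:
  assumes "\<And>n. n \<noteq> 0 \<Longrightarrow> g n = 0"
  shows "conv f g k = f k * g 0"
proof -
  have "conv f g k = infsum (\<lambda>n. f n * g (k - n)) {k}"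
    unfolding conv_def using assms by (intro infsum_cong_neutral) auto
  then show ?thesis by simp
qed

lemma conv_supported_at_pm1:
  assumes "\<And>n. n \<noteq> 1 \<Longrightarrow> n \<noteq> -1 \<Longrightarrow> g n = 0"
  shows "conv f g k = f (k - 1) * g 1 + f (k + 1) * g (-1)"
proof -
  have "conv f g k = infsum (\<lambda>n. f n * g (k - n)) {k - 1, k + 1}"
    unfolding conv_def
  proof (rule infsum_cong_neutral)
    fix n assume "n \<in> UNIV - {k - 1, k + 1}"
    then have "k - n \<noteq> 1" "k - n \<noteq> -1" by auto
    then show "f n * g (k - n) = 0" by (simp add: assms)
  qed auto
  then show ?thesis by simp
qed

section \<open>Series of matrices\<close>

definition homogeneous_ms :: "nat \<Rightarrow> 'a mseries \<Rightarrow> bool" where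
  "homogeneous_ms p P \<longleftrightarrow> (\<forall>i j. homogeneous p (\<lambda>k. P k $ i $ j))"

definition null_ms :: "'a mseries \<Rightarrow> bool" where
  "null_ms P \<longleftrightarrow> (\<forall>i j. null_family (\<lambda>k. P k $ i $ j))"

lemma ms_mult_entry:
  "ms_mult P Q k $ i $ j = (\<Sum>l\<in>UNIV. conv (\<lambda>n. P n $ i $ l) (\<lambda>n. Q n $ l $ j) k)"
  by (simp add: ms_mult_def conv_def)

lemma ms_euler_entry: "ms_euler P k $ i $ j = of_int k * P k $ i $ j"
  by (simp add: ms_euler_def map_matrix_def)

lemma ms_d_entry: "ms_d M P k $ i $ j = ext_d M (P k $ i $ j)"
  by (simp add: ms_d_def map_matrix_def)

lemma ms_adj_entry: "ms_adj M P k $ i $ j = fbar M (P (- k) $ j $ i)"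
  by (simp add: ms_adj_def transpose_def map_matrix_def)

lemma homogeneous_ms_mult:
  "homogeneous_ms p P \<Longrightarrow> homogeneous_ms q Q \<Longrightarrow> homogeneous_ms (p + q) (ms_mult P Q)"
  by (auto simp: homogeneous_ms_def ms_mult_entry intro!: homogeneous_sum homogeneous_conv)

lemma null_ms_mult: "null_ms P \<Longrightarrow> null_ms Q \<Longrightarrow> null_ms (ms_mult P Q)"
  by (auto simp: null_ms_def ms_mult_entry intro!: null_family_sum null_family_conv)

lemma homogeneous_ms_add:
  "homogeneous_ms p P \<Longrightarrow> homogeneous_ms p Q \<Longrightarrow> homogeneous_ms p (\<lambda>k. P k + Q k)"
  by (simp add: homogeneous_ms_def homogeneous_def Forms_add)

lemma homogeneous_ms_diff:
  "homogeneous_ms p P \<Longrightarrow> homogeneous_ms p Q \<Longrightarrow> homogeneous_ms p (\<lambda>k. P k - Q k)"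
  by (simp add: homogeneous_ms_def homogeneous_def Forms_diff)

lemma homogeneous_ms_uminus: "homogeneous_ms p P \<Longrightarrow> homogeneous_ms p (\<lambda>k. - P k)"
  by (simp add: homogeneous_ms_def homogeneous_def Forms_uminus)

lemma null_ms_add: "null_ms P \<Longrightarrow> null_ms Q \<Longrightarrow> null_ms (\<lambda>k. P k + Q k)"
  by (simp add: null_ms_def null_family_add)

lemma homogeneous_ms_euler: "homogeneous_ms p P \<Longrightarrow> homogeneous_ms p (ms_euler P)"
  by (simp add: homogeneous_ms_def ms_euler_entry homogeneous_euler)

lemma null_ms_euler: "null_ms P \<Longrightarrow> null_ms (ms_euler P)"
  by (simp add: null_ms_def ms_euler_entry null_family_mult)

lemma homogeneous_ms_d: "homogeneous_ms p P \<Longrightarrow> homogeneous_ms (Suc p) (ms_d M P)"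
  by (simp add: homogeneous_ms_def homogeneous_def ms_d_entry d_Forms)

lemma null_ms_d: "null_ms P \<Longrightarrow> null_ms (ms_d M P)"
  by (simp add: null_ms_def ms_d_entry null_family_d)

lemma ms_mult_assoc:
  assumes "homogeneous_ms p P" "homogeneous_ms q Q" "homogeneous_ms r R"
    and "null_ms P \<and> null_ms Q \<or> null_ms P \<and> null_ms R \<or> null_ms Q \<and> null_ms R"
  shows "ms_mult (ms_mult P Q) R = ms_mult P (ms_mult Q R)"
proof (intro ext)
  fix k
  let ?e = "\<lambda>X i j n. X n $ i $ j"
  have "ms_mult (ms_mult P Q) R k $ i $ j = ms_mult P (ms_mult Q R) k $ i $ j" for i j
  proof -
    have "ms_mult (ms_mult P Q) R k $ i $ j
        = (\<Sum>l\<in>UNIV. \<Sum>m\<in>UNIV. conv (conv (?e P i m) (?e Q m l)) (?e R l j) k)"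
      unfolding ms_mult_entry[of "ms_mult P Q"] ms_mult_entry[of P]
      using assms by (intro sum.cong refl conv_sum_left[where p = "p + q"] homogeneous_conv)
        (auto simp: homogeneous_ms_def null_ms_def intro: null_family_conv)
    also have "\<dots> = (\<Sum>l\<in>UNIV. \<Sum>m\<in>UNIV. conv (?e P i m) (conv (?e Q m l) (?e R l j)) k)"
      using assms by (intro sum.cong refl conv_assoc) (auto simp: homogeneous_ms_def null_ms_def)
    also have "\<dots> = (\<Sum>m\<in>UNIV. \<Sum>l\<in>UNIV. conv (?e P i m) (conv (?e Q m l) (?e R l j)) k)"
      by (rule sum.swap)
    also have "\<dots> = ms_mult P (ms_mult Q R) k $ i $ j"
      unfolding ms_mult_entry[of P] ms_mult_entry[of Q]
      using assms by (intro sum.cong refl conv_sum_right[where q = "q + r", symmetric] homogeneous_conv)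
        (auto simp: homogeneous_ms_def null_ms_def intro: null_family_conv)
    finally show ?thesis .
  qed
  then show "ms_mult (ms_mult P Q) R k = ms_mult P (ms_mult Q R) k"
    by (simp add: vec_eq_iff)
qed

lemma ms_mult_add_left:
  assumes "homogeneous_ms p P" "homogeneous_ms p P'" "homogeneous_ms q Q" "null_ms P \<and> null_ms P' \<or> null_ms Q"
  shows "ms_mult (\<lambda>k. P k + P' k) Q k = ms_mult P Q k + ms_mult P' Q k"
  using assms
  by (auto simp: vec_eq_iff ms_mult_entry homogeneous_ms_def null_ms_def
      simp flip: sum.distrib intro!: sum.cong conv_add_left)

lemma ms_mult_add_right:
  assumes "homogeneous_ms p P" "homogeneous_ms q Q" "homogeneous_ms q Q'" "null_ms P \<or> null_ms Q \<and> null_ms Q'"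
  shows "ms_mult P (\<lambda>k. Q k + Q' k) k = ms_mult P Q k + ms_mult P Q' k"
  using assms
  by (auto simp: vec_eq_iff ms_mult_entry homogeneous_ms_def null_ms_def
      simp flip: sum.distrib intro!: sum.cong conv_add_right)

lemma ms_mult_uminus_left:
  fixes P Q :: "'a mseries"
  shows "ms_mult (\<lambda>k. - P k) Q k = - ms_mult P Q k"
  by (simp add: vec_eq_iff ms_mult_entry conv_def infsum_uminus sum_negf)

lemma ms_euler_mult:
  assumes "homogeneous_ms p P" "homogeneous_ms q Q" "null_ms P \<or> null_ms Q"
  shows "ms_euler (ms_mult P Q) k = ms_mult (ms_euler P) Q k + ms_mult P (ms_euler Q) k"
proof -
  have "of_int k * conv (\<lambda>n. P n $ i $ l) (\<lambda>n. Q n $ l $ j) k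
      = conv (\<lambda>n. of_int n * P n $ i $ l) (\<lambda>n. Q n $ l $ j) k
        + conv (\<lambda>n. P n $ i $ l) (\<lambda>n. of_int n * Q n $ l $ j) k" for i j l
    using assms by (intro conv_euler) (auto simp: homogeneous_ms_def null_ms_def)
  then show ?thesis
    by (simp add: vec_eq_iff ms_mult_entry ms_euler_entry sum_distrib_left sum.distrib)
qed

lemma ms_d_mult:
  assumes "homogeneous_ms 0 P" "homogeneous_ms q Q" "null_ms P \<or> null_ms Q"
  shows "ms_d M (ms_mult P Q) k = ms_mult (ms_d M P) Q k + ms_mult P (ms_d M Q) k"
proof -
  have "ext_d M (conv (\<lambda>n. P n $ i $ l) (\<lambda>n. Q n $ l $ j) k)
      = conv (\<lambda>n. ext_d M (P n $ i $ l)) (\<lambda>n. Q n $ l $ j) k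
        + conv (\<lambda>n. P n $ i $ l) (\<lambda>n. ext_d M (Q n $ l $ j)) k" for i j l
    using assms by (intro conv_d) (auto simp: homogeneous_ms_def null_ms_def)
  then show ?thesis
    by (simp add: vec_eq_iff ms_mult_entry ms_d_entry d_sum sum.distrib)
qed

lemma trace_ms_mult_anticommute:
  assumes "homogeneous_ms 1 P" "homogeneous_ms 1 Q"
  shows "trace (ms_mult P Q k) = - trace (ms_mult Q P k)"
proof -
  have "trace (ms_mult P Q k)
      = (\<Sum>i\<in>UNIV. \<Sum>l\<in>UNIV. - conv (\<lambda>n. Q n $ l $ i) (\<lambda>n. P n $ i $ l) k)"
    unfolding trace_def ms_mult_entry using assms
    by (intro sum.cong refl conv_anticommute) (auto simp: homogeneous_ms_def)
  also have "\<dots> = (\<Sum>l\<in>UNIV. \<Sum>i\<in>UNIV. - conv (\<lambda>n. Q n $ l $ i) (\<lambda>n. P n $ i $ l) k)"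
    by (rule sum.swap)
  finally show ?thesis by (simp add: trace_def ms_mult_entry sum_negf)
qed

lemma ms_d_euler: "ms_d M (ms_euler P) = ms_euler (ms_d M P)"
  by (simp add: fun_eq_iff vec_eq_iff ms_d_entry ms_euler_entry d_of_int_mult)

lemma ms_euler_add: "ms_euler (\<lambda>k. P k + Q k) k = ms_euler P k + ms_euler Q k"
  by (simp add: vec_eq_iff ms_euler_entry distrib_left)

lemma d_trace: "ext_d M (trace (P k)) = trace (ms_d M P k)"
  by (simp add: trace_def ms_d_entry d_sum)

lemma trace_linear:
  fixes A B :: "'a ^ 2 ^ 2"
  shows "trace (A + B) = trace A + trace B" and "trace (A - B) = trace A - trace B"
  by (simp_all add: trace_def sum.distrib sum_subtractf)

text \<open>
  Expanding both sides by the two Leibniz rules, the difference is a combination of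
  \<open>tr(\<Phi> Y D\<Phi>)\<close>, \<open>tr(Y D\<Phi> \<Phi>)\<close> and \<open>tr(Y \<Phi> D\<Phi>)\<close>. The first two are negatives of each other by
  cyclicity, since \<open>\<Phi>\<close> is moved past the 1-form \<open>Y D\<Phi>\<close>; the third cancels by itself.
  Every triple product here contains two null factors, as associativity requires.
\<close>

lemma d_trace_Killing_euler:
  assumes Y: "homogeneous_ms 0 Y" and \<Phi>: "homogeneous_ms 1 \<Phi>" "null_ms \<Phi>"
  shows "ext_d M (trace (ms_mult Y (ms_euler \<Phi>) k)) =
    trace (ms_mult (\<lambda>k. ms_d M Y k + ms_comm \<Phi> Y k) (ms_euler \<Phi>) k)
    + trace (ms_mult Y (ms_euler (\<lambda>k. ms_d M \<Phi> k + ms_mult \<Phi> \<Phi> k)) k)"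
proof -
  define E where "E = ms_euler \<Phi>"
  have E: "homogeneous_ms 1 E" "null_ms E"
    unfolding E_def by (intro homogeneous_ms_euler null_ms_euler \<Phi>)+
  have dY: "homogeneous_ms 1 (ms_d M Y)" and d\<Phi>: "homogeneous_ms 2 (ms_d M \<Phi>)" "null_ms (ms_d M \<Phi>)"
    using homogeneous_ms_d[OF Y] homogeneous_ms_d[OF \<Phi>(1)] null_ms_d[OF \<Phi>(2)]
    by (simp_all add: numeral_2_eq_2)
  have products: "homogeneous_ms 1 (ms_mult \<Phi> Y)" "homogeneous_ms 1 (ms_mult Y \<Phi>)" "homogeneous_ms 1 (ms_mult Y E)"
      "homogeneous_ms 2 (ms_mult E \<Phi>)" "homogeneous_ms 2 (ms_mult \<Phi> E)" "homogeneous_ms 2 (ms_mult \<Phi> \<Phi>)"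
    using homogeneous_ms_mult[OF \<Phi>(1) Y] homogeneous_ms_mult[OF Y \<Phi>(1)] homogeneous_ms_mult[OF Y E(1)]
      homogeneous_ms_mult[OF E(1) \<Phi>(1)] homogeneous_ms_mult[OF \<Phi>(1) E(1)] homogeneous_ms_mult[OF \<Phi>(1) \<Phi>(1)]
    by (simp_all add: numeral_2_eq_2)
  have left: "ms_mult (\<lambda>k. ms_d M Y k + ms_comm \<Phi> Y k) E k
      = ms_mult (ms_d M Y) E k + (ms_mult (ms_mult \<Phi> Y) E k - ms_mult (ms_mult Y \<Phi>) E k)"
  proof -
    have "ms_mult (\<lambda>k. ms_d M Y k + ms_comm \<Phi> Y k) E k
        = ms_mult (ms_d M Y) E k + ms_mult (ms_comm \<Phi> Y) E k"
      using dY products E unfolding ms_comm_def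
      by (intro ms_mult_add_left[of 1 _ _ 1] homogeneous_ms_diff) auto
    moreover have "ms_mult (\<lambda>k. ms_mult \<Phi> Y k + - ms_mult Y \<Phi> k) E k
        = ms_mult (ms_mult \<Phi> Y) E k + ms_mult (\<lambda>k. - ms_mult Y \<Phi> k) E k"
      using products E by (intro ms_mult_add_left[of 1 _ _ 1] homogeneous_ms_uminus) auto
    ultimately show ?thesis by (simp add: ms_mult_uminus_left ms_comm_def[abs_def])
  qed
  have right: "ms_mult Y (ms_euler (\<lambda>k. ms_d M \<Phi> k + ms_mult \<Phi> \<Phi> k)) k
      = ms_mult Y (ms_d M E) k + (ms_mult Y (ms_mult E \<Phi>) k + ms_mult Y (ms_mult \<Phi> E) k)"
  proof -
    have "ms_euler (\<lambda>k. ms_d M \<Phi> k + ms_mult \<Phi> \<Phi> k)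
        = (\<lambda>k. ms_d M E k + (ms_mult E \<Phi> k + ms_mult \<Phi> E k))"
      using \<Phi> by (auto simp: ms_euler_add E_def ms_d_euler ms_euler_mult[of 1 _ 1])
    moreover have "ms_mult Y (\<lambda>k. ms_d M E k + (ms_mult E \<Phi> k + ms_mult \<Phi> E k)) k
        = ms_mult Y (ms_d M E) k + ms_mult Y (\<lambda>k. ms_mult E \<Phi> k + ms_mult \<Phi> E k) k"
      using Y products d\<Phi> E \<Phi>
      by (intro ms_mult_add_right[of 0 _ 2] homogeneous_ms_add)
         (auto simp: E_def ms_d_euler intro!: homogeneous_ms_euler null_ms_euler null_ms_add null_ms_mult)
    moreover have "ms_mult Y (\<lambda>k. ms_mult E \<Phi> k + ms_mult \<Phi> E k) k
        = ms_mult Y (ms_mult E \<Phi>) k + ms_mult Y (ms_mult \<Phi> E) k"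
      using Y products E \<Phi> by (intro ms_mult_add_right[of 0 _ 2]) (auto intro!: null_ms_mult)
    ultimately show ?thesis by simp
  qed
  have "trace (ms_mult (ms_mult \<Phi> Y) E k) = trace (ms_mult \<Phi> (ms_mult Y E) k)"
    using ms_mult_assoc[OF \<Phi>(1) Y E(1)] \<Phi> E by simp
  also have "\<dots> = - trace (ms_mult (ms_mult Y E) \<Phi> k)"
    by (intro trace_ms_mult_anticommute \<Phi> products)
  also have "ms_mult (ms_mult Y E) \<Phi> = ms_mult Y (ms_mult E \<Phi>)"
    using ms_mult_assoc[OF Y E(1) \<Phi>(1)] \<Phi> E by simp
  finally have cyc: "trace (ms_mult (ms_mult \<Phi> Y) E k) = - trace (ms_mult Y (ms_mult E \<Phi>) k)" .
  have assoc: "ms_mult (ms_mult Y \<Phi>) E = ms_mult Y (ms_mult \<Phi> E)"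
    using ms_mult_assoc[OF Y \<Phi>(1) E(1)] \<Phi> E by simp
  have "ext_d M (trace (ms_mult Y E k)) = trace (ms_mult (ms_d M Y) E k) + trace (ms_mult Y (ms_d M E) k)"
    unfolding d_trace using ms_d_mult[OF Y E(1)] E by (simp add: trace_linear)
  then show ?thesis
    unfolding E_def[symmetric] left right trace_linear cyc assoc by simp
qed

end

section \<open>The Killing field and the extended Maurer-Cartan form\<close>

lemma mat2_entry [simp]:
  "mat2 p q r s $ 1 $ 1 = p" "mat2 p q r s $ 1 $ 2 = q"
  "mat2 p q r s $ 2 $ 1 = r" "mat2 p q r s $ 2 $ 2 = s"
  by (simp_all add: mat2_def)

text \<open>
  The twisting condition of the loop algebra: even powers of \<open>\<lambda>\<close> on the diagonal and odd powers off
  the diagonal.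
\<close>

definition parity_graded :: "'a :: zero mseries \<Rightarrow> bool" where
  "parity_graded P \<longleftrightarrow> (\<forall>k i j. (even k \<longleftrightarrow> i \<noteq> j) \<longrightarrow> P k $ i $ j = 0)"

context cmc_forms
begin

lemma trace_ms_mult_parity:
  fixes P Q :: "'a mseries"
  assumes "parity_graded P" "parity_graded Q" "odd k"
  shows "trace (ms_mult P Q k) = 0"
proof -
  have "conv (\<lambda>n. P n $ i $ l) (\<lambda>n. Q n $ l $ i) k = 0" for i l
  proof (rule conv_eq_zero)
    fix n
    \<comment> \<open>Otherwise \<open>n\<close> and \<open>k - n\<close> would have the same parity, making \<open>k\<close> even.\<close>
    have "(even n \<longleftrightarrow> i \<noteq> l) \<or> (even (k - n) \<longleftrightarrow> l \<noteq> i)"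
      using assms(3) by auto
    then show "P n $ i $ l * Q (k - n) $ l $ i = 0"
      using assms(1,2) unfolding parity_graded_def by (metis mult_zero_left mult_zero_right)
  qed
  then show ?thesis by (simp add: trace_def ms_mult_entry)
qed

lemma z_polys_Forms: "x \<in> z_polys M \<Longrightarrow> x \<in> Forms M 0"
proof (induction rule: z_polys.induct)
  case (gen j)
  then show ?case by (intro Forms_mult_0 Forms_power rt_inv_Forms jet_Forms) simp
qed (auto intro: scal_Forms Forms_add Forms_mult_0)

lemma xi_bar_Forms: "fbar M (xi M) \<in> Forms M 1"
  by (intro bar_Forms xi_Forms)

lemma phi_lambda_entry:
  "phi_lambda M k $ 1 $ 1 = (if k = 0 then scal M (\<i> / 2) * rho M else 0)"
  "phi_lambda M k $ 1 $ 2 = (if k = 1 then - (scal M (complex_of_real (gam M) / 2) * fbar M (xi M))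
     else if k = -1 then - (scal M (1 / 2) * jet M 2 * xi M) else 0)"
  "phi_lambda M k $ 2 $ 1 = (if k = 1 then scal M (1 / 2) * fbar M (jet M 2) * fbar M (xi M)
     else if k = -1 then scal M (complex_of_real (gam M) / 2) * xi M else 0)"
  "phi_lambda M k $ 2 $ 2 = - (phi_lambda M k $ 1 $ 1)"
  by (simp_all add: phi_lambda_def)

lemma homogeneous_phi_lambda: "homogeneous_ms 1 (phi_lambda M)"
  unfolding homogeneous_ms_def homogeneous_def forall_2
  by (auto simp: phi_lambda_entry mult.assoc intro!: Forms_zero Forms_uminus Forms_scal_mult
    Forms_mult_0[where p = 1, simplified] bar_Forms jet_Forms
    xi_Forms[simplified] xi_bar_Forms[simplified] rho_Forms[simplified])

lemma null_phi_lambda: "null_ms (phi_lambda M)"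
  unfolding null_ms_def
proof (intro allI null_familyI)
  fix i j N
  have "phi_lambda M k = 0" if "k \<notin> {-1, 0, 1}" for k
    using that by (simp add: phi_lambda_def)
  then show "\<exists>F. finite F \<and> (\<forall>k. k \<notin> F \<longrightarrow> phi_lambda M k $ i $ j \<in> tail_ideal N)"
    by (intro exI[of _ "{-1, 0, 1}"]) (auto simp: closed_ideal_zero[OF closed_ideal_ideal_gen])
qed

lemma parity_phi_lambda: "parity_graded (phi_lambda M)"
  unfolding parity_graded_def forall_2 by (auto simp: phi_lambda_entry)

end

locale cmc_killing = cmc_forms M
  for M :: "('a :: {ring_1, topological_ab_group_add, topological_semigroup_mult, t2_space}, 'b)
              cmc_data_scheme" +
  fixes a b c :: "nat \<Rightarrow> 'a"
  assumes canonical: "canonical_killing M a b c"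
begin

abbreviation Y :: "'a mseries" where "Y \<equiv> killing M a b c"
abbreviation A :: "int \<Rightarrow> 'a" where "A \<equiv> ser_a a"
abbreviation B :: "int \<Rightarrow> 'a" where "B \<equiv> ser_bc b"
abbreviation C :: "int \<Rightarrow> 'a" where "C \<equiv> ser_bc c"
abbreviation \<Phi> :: "'a mseries" where "\<Phi> \<equiv> phi_ext M a b c"

text \<open>
  By normalization \<open>b\<close> and \<open>c\<close> are polynomials in the \<open>z\<^sub>j\<close> only after multiplication by a power of
  \<open>h\<^sub>2\<^bsup>1/2\<^esup>\<close>, which is undone by its inverse.
\<close>

lemma coefficients_Forms: "A k \<in> Forms M 0" "B k \<in> Forms M 0" "C k \<in> Forms M 0"
proof -
  have rt: "x \<in> Forms M 0" if "rt M * x \<in> Forms M 0" for x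
  proof -
    have "rt_inv M * (rt M * x) = x"
      using rt_inverse zero_form_commute[OF rt_Forms rt_inv_Forms] by (simp flip: mult.assoc)
    then show ?thesis using Forms_mult_0[OF rt_inv_Forms that] by simp
  qed
  have rt_inv: "x \<in> Forms M 0" if "rt_inv M * x \<in> Forms M 0" for x
  proof -
    have "rt M * (rt_inv M * x) = x"
      using rt_inverse by (simp flip: mult.assoc)
    then show ?thesis using Forms_mult_0[OF rt_Forms that] by simp
  qed
  have odd: "a (2 * n + 1) \<in> Forms M 0" and even: "b (2 * n + 2) \<in> Forms M 0" "c (2 * n + 2) \<in> Forms M 0" for n
    using canonical z_polys_Forms rt rt_inv unfolding canonical_killing_def by blast+
  show "A k \<in> Forms M 0"
  proof (cases "k \<ge> 0 \<and> even k")
    case True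
    then have "even (nat k)" by (simp add: even_nat_iff)
    then obtain n where "nat k = 2 * n" by (rule evenE)
    then show ?thesis using True odd[of n] by (simp add: ser_a_def)
  qed (auto simp: ser_a_def Forms_zero)
  show "B k \<in> Forms M 0" "C k \<in> Forms M 0"
  proof -
    have "x (nat k + 1) \<in> Forms M 0" if "k \<ge> 0 \<and> odd k" "\<And>n. x (2 * n + 2) \<in> Forms M 0" for x
    proof -
      have "odd (nat k)" using that(1) by (simp add: even_nat_iff)
      then obtain n where "nat k = 2 * n + 1" by (rule oddE)
      then show ?thesis using that(2)[of n] by simp
    qed
    then show "B k \<in> Forms M 0" "C k \<in> Forms M 0"
      using even by (auto simp: ser_bc_def Forms_zero)
  qed
qed

lemma killing_entry:
  "Y k $ 1 $ 1 = - (scal M \<i> * A k)" "Y k $ 1 $ 2 = 2 * C k"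
  "Y k $ 2 $ 1 = 2 * B k" "Y k $ 2 $ 2 = scal M \<i> * A k"
  by (simp_all add: killing_def)

lemma homogeneous_killing: "homogeneous_ms 0 Y"
  unfolding homogeneous_ms_def homogeneous_def forall_2
  by (auto simp: killing_entry intro!: Forms_uminus Forms_scal_mult Forms_double coefficients_Forms)

lemma parity_killing: "parity_graded Y"
  unfolding parity_graded_def forall_2 by (auto simp: killing_entry ser_a_def ser_bc_def)

lemma killing_negative: "k < 0 \<Longrightarrow> Y k $ i $ j = 0"
  using exhaust_2[of i] exhaust_2[of j] by (auto simp: killing_entry ser_a_def ser_bc_def)

lemma U_part_entry:
  "U_part M a b c m k $ i $ j
     = (if k \<le> -1 then scal M (1 / (2 * \<i>)) * Y (k + 2 * int m + 2) $ i $ j else 0)"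
  by (simp add: U_part_def map_matrix_def)

text \<open>What the extended Maurer-Cartan form adds to \<open>\<phi>\<^sub>\<lambda>\<close> along the higher flows.\<close>

definition flow_part :: "'a mseries" where
  "flow_part k = (\<chi> i j.
     - (\<Sum>\<^sub>\<infinity>m\<in>{1..}. ms_adj M (U_part M a b c m) k $ i $ j * ext_d M (fbar M (tim M m)))
     + (\<Sum>\<^sub>\<infinity>m\<in>{1..}. U_part M a b c m k $ i $ j * ext_d M (tim M m)))"

lemma phi_ext_eq: "\<Phi> k = phi_lambda M k + flow_part k"
  by (simp add: vec_eq_iff phi_ext_def flow_part_def)

lemma U_part_Forms: "U_part M a b c m k $ i $ j \<in> Forms M 0"
  using homogeneous_killing
  by (auto simp: U_part_entry homogeneous_ms_def homogeneous_def intro!: Forms_scal_mult Forms_zero)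

lemma homogeneous_flow_part: "homogeneous_ms 1 flow_part"
proof -
  have "ext_d M (tim M m) \<in> Forms M 1" "ext_d M (fbar M (tim M m)) \<in> Forms M 1" for m
    using d_Forms[OF tim_Forms] d_Forms[OF bar_Forms[OF tim_Forms]] by simp_all
  then show ?thesis
    unfolding homogeneous_ms_def homogeneous_def flow_part_def
    by (auto simp: ms_adj_entry intro!: Forms_diff Forms_infsum
      Forms_mult_0[where p = 1, simplified] bar_Forms U_part_Forms)
qed

text \<open>
  The coefficient of \<open>\<lambda>\<^sup>k\<close> in \<open>U\<^sub>m\<close> comes from the one of degree \<open>k + 2m + 2\<close> in the power series
  \<open>Y\<close>. For \<open>m \<le> N\<close> this degree is negative as soon as \<open>k < -2N-2\<close>; the conjugate part mirrors this
  at large positive \<open>k\<close>. For \<open>N = 0\<close> there is no restriction on \<open>k\<close>, as the sums start at \<open>m = 1\<close>.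
\<close>

lemma flow_part_tail_ideal:
  assumes "N = 0 \<or> \<bar>k\<bar> > 2 * int N + 2"
  shows "flow_part k $ i $ j \<in> tail_ideal N"
proof -
  note ideal = closed_ideal_ideal_gen[of "dt_beyond M N"]
  have low: "U_part M a b c m l $ i $ j = 0" if "\<bar>l\<bar> = \<bar>k\<bar>" "\<not> m > N" "m \<ge> 1" for m l i j
  proof (cases "l \<le> -1")
    case True
    then show ?thesis using that assms by (auto simp: U_part_entry killing_negative)
  qed (simp add: U_part_entry)
  have high: "ext_d M (tim M m) \<in> tail_ideal N" "ext_d M (fbar M (tim M m)) \<in> tail_ideal N" if "m > N" for m
    using that ideal_gen_superset[of "dt_beyond M N"] by (auto simp: dt_beyond_def)
  have "U_part M a b c m k $ i $ j * ext_d M (tim M m) \<in> tail_ideal N" if "m \<ge> 1" for m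
    using that low[of k m] high[of m] by (cases "m > N") (auto simp: closed_ideal_zero[OF ideal] tail_ideal_mult)
  moreover have "ms_adj M (U_part M a b c m) k $ i $ j * ext_d M (fbar M (tim M m)) \<in> tail_ideal N" if "m \<ge> 1" for m
    using that low[of "- k" m] high[of m]
    by (cases "m > N") (auto simp: ms_adj_entry bar_zero closed_ideal_zero[OF ideal] tail_ideal_mult)
  ultimately show ?thesis
    unfolding flow_part_def by (auto intro!: closed_ideal_diff infsum_in_closed_ideal ideal)
qed

lemma null_flow_part: "null_ms flow_part"
  unfolding null_ms_def
proof (intro allI null_familyI)
  fix i j N
  show "\<exists>F. finite F \<and> (\<forall>k. k \<notin> F \<longrightarrow> flow_part k $ i $ j \<in> tail_ideal N)"
    by (intro exI[of _ "{- (2 * int N + 2) .. 2 * int N + 2}"]) (auto intro!: flow_part_tail_ideal)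
qed

lemma homogeneous_phi_ext: "homogeneous_ms 1 \<Phi>"
  using homogeneous_ms_add[OF homogeneous_phi_lambda homogeneous_flow_part] by (simp flip: phi_ext_eq)

lemma null_phi_ext: "null_ms \<Phi>"
  using null_ms_add[OF null_phi_lambda null_flow_part] by (simp flip: phi_ext_eq)

lemma parity_phi_ext: "parity_graded \<Phi>"
proof -
  have "U_part M a b c m k $ i $ j = 0" if "even k \<longleftrightarrow> i \<noteq> j" for m k i j
  proof -
    have "even (k + 2 * int m + 2) \<longleftrightarrow> i \<noteq> j" using that by simp
    then show ?thesis using parity_killing unfolding parity_graded_def U_part_entry by simp
  qed
  then have "parity_graded flow_part"
    unfolding parity_graded_def flow_part_def by (auto simp: ms_adj_entry bar_zero)
  then show ?thesis
    using parity_phi_lambda unfolding parity_graded_def phi_ext_eq by simp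
qed

lemma parity_euler: "parity_graded P \<Longrightarrow> parity_graded (ms_euler P)" for P :: "'a mseries"
  by (simp add: parity_graded_def ms_euler_entry)

lemma varphi_Y_odd: "odd k \<Longrightarrow> varphi_Y M a b c k = 0"
  unfolding varphi_Y_def by (intro trace_ms_mult_parity parity_killing parity_euler parity_phi_ext)

lemma varphi_Y_Forms: "varphi_Y M a b c k \<in> Forms M 1"
  using homogeneous_ms_mult[OF homogeneous_killing homogeneous_ms_euler[OF homogeneous_phi_ext]]
  unfolding varphi_Y_def trace_def homogeneous_ms_def homogeneous_def by (auto intro: Forms_sum)

lemma ms_mult_in_ideal:
  fixes P Q :: "'a mseries"
  assumes K: "closed_ideal K" and "ms_entries P \<subseteq> K \<or> ms_entries Q \<subseteq> K"
  shows "ms_mult P Q k $ i $ j \<in> K" and "trace (ms_mult P Q k) \<in> K"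
proof -
  have "P n $ i $ j * Q l $ i' $ j' \<in> K" for n i j l i' j'
    using assms closed_ideal_mult_left[OF K] closed_ideal_mult_right[OF K]
    unfolding ms_entries_def by blast
  then show entry: "ms_mult P Q k $ i $ j \<in> K" for i j
    unfolding ms_mult_entry conv_def
    by (auto intro!: closed_ideal_sum[OF K] infsum_in_closed_ideal[OF K])
  show "trace (ms_mult P Q k) \<in> K"
    unfolding trace_def by (intro closed_ideal_sum[OF K] entry)
qed

lemma ms_euler_in_ideal:
  fixes P :: "'a mseries"
  assumes K: "closed_ideal K" and P: "ms_entries P \<subseteq> K"
  shows "ms_entries (ms_euler P) \<subseteq> K"
proof -
  have "of_int k * P k $ i $ j \<in> K" for k i j
    using P by (intro closed_ideal_mult_left[OF K]) (auto simp: ms_entries_def)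
  then show ?thesis unfolding ms_entries_def ms_euler_entry by blast
qed

text \<open>
  Both traces on the right of \<open>d_trace_Killing_euler\<close> are infinite sums of multiples of structure
  equations, and the ideal is closed.
\<close>

lemma d_varphi_Y: "ext_d M (varphi_Y M a b c k) \<in> hierarchy_ideal M a b c"
proof -
  let ?J = "hierarchy_ideal M a b c"
  have J: "closed_ideal ?J"
    unfolding hierarchy_ideal_def by (rule closed_ideal_diff_ideal_gen)
  have gens: "ms_entries (\<lambda>k. ms_d M Y k + ms_comm \<Phi> Y k) \<subseteq> ?J"
    "ms_entries (\<lambda>k. ms_d M \<Phi> k + ms_mult \<Phi> \<Phi> k) \<subseteq> ?J"
    using diff_ideal_gen_superset[of "hierarchy_eqs M a b c" M]
    unfolding hierarchy_ideal_def hierarchy_eqs_def Let_def by blast+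
  show ?thesis
    unfolding varphi_Y_def
      d_trace_Killing_euler[OF homogeneous_killing homogeneous_phi_ext null_phi_ext]
    using gens ms_euler_in_ideal[OF J gens(2)]
    by (intro closed_ideal_add[OF J] ms_mult_in_ideal(2)[OF J]) simp_all
qed

section \<open>Comparison with the CMC system\<close>

lemmas jet2_Forms = jet_Forms[of 2, simplified] bar_Forms[OF jet_Forms[of 2, simplified]]

text \<open>
  The next rules bring a product into the normal form constant, \<open>h\<^sub>2\<close> or its conjugate, coefficient
  of \<open>Y\<close>, 1-form.
\<close>

lemmas jets_in_front =
  zero_form_left_commute[of "A _" "jet M 2"] zero_form_left_commute[of "A _" "fbar M (jet M 2)"]
  zero_form_left_commute[of "B _" "jet M 2"] zero_form_left_commute[of "C _" "fbar M (jet M 2)"]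

lemmas normalize_products = mult.assoc zero_form_scal scal_scal jets_in_front
  coefficients_Forms jet2_Forms scal_one double_eq_scal

lemma conv_phi_lambda:
  "conv (\<lambda>n. 2 * C n) (\<lambda>n. phi_lambda M n $ 1 $ 1) k = scal M \<i> * (C k * rho M)"
  "conv (\<lambda>n. 2 * B n) (\<lambda>n. phi_lambda M n $ 1 $ 1) k = scal M \<i> * (B k * rho M)"
  "conv (\<lambda>n. 2 * B n) (\<lambda>n. phi_lambda M n $ 1 $ 2) k
     = - (scal M (complex_of_real (gam M)) * (B (k - 1) * fbar M (xi M))) - jet M 2 * (B (k + 1) * xi M)"
  "conv (\<lambda>n. 2 * C n) (\<lambda>n. phi_lambda M n $ 2 $ 1) k
     = fbar M (jet M 2) * (C (k - 1) * fbar M (xi M)) + scal M (complex_of_real (gam M)) * (C (k + 1) * xi M)"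
  "conv (\<lambda>n. scal M \<i> * A n) (\<lambda>n. phi_lambda M n $ 1 $ 2) k
     = - (scal M (\<i> / 2 * complex_of_real (gam M)) * (A (k - 1) * fbar M (xi M)))
       - scal M (\<i> / 2) * (jet M 2 * (A (k + 1) * xi M))"
  "conv (\<lambda>n. scal M \<i> * A n) (\<lambda>n. phi_lambda M n $ 2 $ 1) k
     = scal M (\<i> / 2) * (fbar M (jet M 2) * (A (k - 1) * fbar M (xi M)))
       + scal M (\<i> / 2 * complex_of_real (gam M)) * (A (k + 1) * xi M)"
proof -
  show "conv (\<lambda>n. 2 * C n) (\<lambda>n. phi_lambda M n $ 1 $ 1) k = scal M \<i> * (C k * rho M)"
    "conv (\<lambda>n. 2 * B n) (\<lambda>n. phi_lambda M n $ 1 $ 1) k = scal M \<i> * (B k * rho M)"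
    by (subst conv_supported_at_0; simp add: phi_lambda_entry normalize_products)+
  show "conv (\<lambda>n. 2 * B n) (\<lambda>n. phi_lambda M n $ 1 $ 2) k
     = - (scal M (complex_of_real (gam M)) * (B (k - 1) * fbar M (xi M))) - jet M 2 * (B (k + 1) * xi M)"
    "conv (\<lambda>n. 2 * C n) (\<lambda>n. phi_lambda M n $ 2 $ 1) k
     = fbar M (jet M 2) * (C (k - 1) * fbar M (xi M)) + scal M (complex_of_real (gam M)) * (C (k + 1) * xi M)"
    "conv (\<lambda>n. scal M \<i> * A n) (\<lambda>n. phi_lambda M n $ 1 $ 2) k
     = - (scal M (\<i> / 2 * complex_of_real (gam M)) * (A (k - 1) * fbar M (xi M)))
       - scal M (\<i> / 2) * (jet M 2 * (A (k + 1) * xi M))"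
    "conv (\<lambda>n. scal M \<i> * A n) (\<lambda>n. phi_lambda M n $ 2 $ 1) k
     = scal M (\<i> / 2) * (fbar M (jet M 2) * (A (k - 1) * fbar M (xi M)))
       + scal M (\<i> / 2 * complex_of_real (gam M)) * (A (k + 1) * xi M)"
    by (subst conv_supported_at_pm1; simp add: phi_lambda_entry normalize_products)+
qed

text \<open>
  The upper left entry of the Killing equation, multiplied by \<open>-1\<close>, and the lower left and upper
  right entries divided by \<open>2\<close>. The ideal \<open>K\<close> is kept general because the components are needed
  both modulo the CMC system and modulo the hierarchy together with the \<open>dt\<^sub>m\<close>, \<open>dtbar\<^sub>m\<close>.
\<close>

lemma killing_equation_components:
  assumes K: "closed_ideal K"
    and eq: "ms_entries (\<lambda>k. ms_d M Y k + ms_comm (phi_lambda M) Y k) \<subseteq> K"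
  shows "scal M \<i> * ext_d M (A k)
      + scal M (complex_of_real (gam M)) * (C (k + 1) * xi M + B (k - 1) * fbar M (xi M))
      + (jet M 2 * (B (k + 1) * xi M) + fbar M (jet M 2) * (C (k - 1) * fbar M (xi M))) \<in> K"
    and "ext_d M (B k) - scal M \<i> * (B k * rho M)
      - (scal M (\<i> / 2) * (fbar M (jet M 2) * (A (k - 1) * fbar M (xi M)))
      + scal M (\<i> / 2 * complex_of_real (gam M)) * (A (k + 1) * xi M)) \<in> K"
    and "ext_d M (C k) + scal M \<i> * (C k * rho M)
      - (scal M (\<i> / 2 * complex_of_real (gam M)) * (A (k - 1) * fbar M (xi M))
      + scal M (\<i> / 2) * (jet M 2 * (A (k + 1) * xi M))) \<in> K"
proof -
  let ?p = "\<lambda>i j n. phi_lambda M n $ i $ j" and ?a = "\<lambda>n. scal M \<i> * A n"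
    and ?b = "\<lambda>n. 2 * B n" and ?c = "\<lambda>n. 2 * C n"
  have hom: "homogeneous 0 ?a" "homogeneous 0 ?b" "homogeneous 0 ?c" "homogeneous 1 (?p i j)" for i j
    using homogeneous_phi_lambda
    by (auto simp: homogeneous_def homogeneous_ms_def intro!: Forms_scal_mult Forms_double coefficients_Forms)
  note commute = hom(1-3)[THEN conv_commute_zero_forms, OF hom(4), symmetric]
  \<comment> \<open>Off the diagonal the two halves of the commutator agree, so every term occurs twice.\<close>
  have half: "x - y - z \<in> K" if "t \<in> K" "t = 2 * x - y - y - z - z" for t x y z
  proof -
    have "t = 2 * (x - y - z)"
      using that(2) by (simp add: mult_2 algebra_simps)
    then have "scal M (1 / 2) * t = scal M (1 / 2 * 2) * (x - y - z)"
      by (metis scal_scal scal_numeral)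
    then show ?thesis
      using closed_ideal_mult_left[OF K that(1), of "scal M (1 / 2)"] by (simp add: scal_one)
  qed
  have entry: "(ms_d M Y k + ms_comm (phi_lambda M) Y k) $ i $ j \<in> K" for i j
    using eq by (auto simp: ms_entries_def)
  have double: "ext_d M (2 * x) = 2 * ext_d M x" for x
    using d_of_int_mult[of 2 x] by simp
  note expand = ms_d_entry ms_comm_def ms_mult_entry sum_2 killing_entry phi_lambda_entry(4)
    vector_add_component vector_minus_component conv_uminus commute conv_phi_lambda double d_uminus d_scal_mult
  show "scal M \<i> * ext_d M (A k)
      + scal M (complex_of_real (gam M)) * (C (k + 1) * xi M + B (k - 1) * fbar M (xi M))
      + (jet M 2 * (B (k + 1) * xi M) + fbar M (jet M 2) * (C (k - 1) * fbar M (xi M))) \<in> K"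
    using closed_ideal_minus[OF K entry[of 1 1]] by (simp add: expand algebra_simps)
  let ?S = "scal M (\<i> / 2) * (fbar M (jet M 2) * (A (k - 1) * fbar M (xi M)))
      + scal M (\<i> / 2 * complex_of_real (gam M)) * (A (k + 1) * xi M)"
    and ?T = "scal M (\<i> / 2 * complex_of_real (gam M)) * (A (k - 1) * fbar M (xi M))
      + scal M (\<i> / 2) * (jet M 2 * (A (k + 1) * xi M))"
  show "ext_d M (B k) - scal M \<i> * (B k * rho M) - ?S \<in> K"
    by (rule half[OF entry[of 2 1]], simp only: expand)
       (simp only: diff_conv_add_uminus minus_add_distrib minus_minus ac_simps)
  have "ext_d M (C k) - - (scal M \<i> * (C k * rho M)) - ?T \<in> K"
    by (rule half[OF entry[of 1 2]], simp only: expand)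
       (simp only: diff_conv_add_uminus minus_add_distrib minus_minus ac_simps)
  then show "ext_d M (C k) + scal M \<i> * (C k * rho M) - ?T \<in> K"
    by (simp only: diff_minus_eq_add)
qed

text \<open>For \<open>n = 0\<close> this uses the convention \<open>b\<^sup>0 = 0\<close>.\<close>

lemma varphi_eq:
  "varphi M b c n = C (2 * int n + 1) * xi M + B (2 * int n - 1) * fbar M (xi M)"
proof -
  have "b (2 * n) = B (2 * int n - 1)"
  proof (cases n)
    case 0
    then show ?thesis using canonical by (simp add: canonical_killing_def ser_bc_def)
  next
    case (Suc m)
    then show ?thesis by (simp add: ser_bc_def nat_add_distrib nat_mult_distrib)
  qed
  moreover have "c (2 * n + 2) = C (2 * int n + 1)"
    by (simp add: ser_bc_def nat_add_distrib nat_mult_distrib)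
  ultimately show ?thesis by (simp add: varphi_def)
qed

text \<open>
  Substituting the Killing equation for \<open>db\<close>, \<open>dc\<close> and the structure equations for the differentials
  of \<open>\<xi>\<close> and its conjugate, the connection terms with \<open>\<rho>\<close> cancel, the terms with \<open>h\<^sub>2\<close> contain a
  squared 1-form, and the two terms with \<open>a\<close> are opposite by anticommutativity.
\<close>

lemma d_cmc_conservation_law:
  "ext_d M (C (k + 1) * xi M + B (k - 1) * fbar M (xi M)) \<in> cmc_ideal M"
proof -
  let ?K = "cmc_ideal M" and ?x = "xi M" and ?y = "fbar M (xi M)"
  let ?g = "\<i> / 2 * complex_of_real (gam M)"
  have K: "closed_ideal ?K"
    unfolding cmc_ideal_def by (rule closed_ideal_diff_ideal_gen)
  have eqs: "cmc_eqs M \<subseteq> ?K"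
    unfolding cmc_ideal_def by (rule diff_ideal_gen_superset)
  have dx: "ext_d M ?x - scal M \<i> * rho M * ?x \<in> ?K"
    using eqs by (auto simp: cmc_eqs_def Let_def)
  have "fbar M (ext_d M ?x - scal M \<i> * rho M * ?x) \<in> ?K"
    using eqs by (auto simp: cmc_eqs_def Let_def)
  then have dy: "ext_d M ?y + scal M \<i> * rho M * ?y \<in> ?K"
    by (simp add: bar_diff bar_mult bar_d bar_scal rho_bar scal_uminus)
  have killing: "ms_entries (\<lambda>k. ms_d M Y k + ms_comm (phi_lambda M) Y k) \<subseteq> ?K"
    using canonical by (simp add: canonical_killing_def)
  \<comment> \<open>The defects of the equations for \<open>dc\<close> and \<open>db\<close> at the neighbouring degrees \<open>k + 1\<close> and \<open>k - 1\<close>,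
    where the same coefficient \<open>A k\<close> occurs in both.\<close>
  define eC eB where "eC = ext_d M (C (k + 1)) + scal M \<i> * (C (k + 1) * rho M)
      - (scal M ?g * (A k * ?y) + scal M (\<i> / 2) * (jet M 2 * (A (k + 2) * ?x)))"
    and "eB = ext_d M (B (k - 1)) - scal M \<i> * (B (k - 1) * rho M)
      - (scal M (\<i> / 2) * (fbar M (jet M 2) * (A (k - 2) * ?y)) + scal M ?g * (A k * ?x))"
  have eC: "eC \<in> ?K" and eB: "eB \<in> ?K"
    using killing_equation_components(3)[OF K killing, of "k + 1"]
      killing_equation_components(2)[OF K killing, of "k - 1"]
    by (simp_all add: eC_def eB_def algebra_simps)
  have "eC * ?x + C (k + 1) * (ext_d M ?x - scal M \<i> * rho M * ?x)
      + (eB * ?y + B (k - 1) * (ext_d M ?y + scal M \<i> * rho M * ?y)) \<in> ?K"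
    by (intro closed_ideal_add[OF K] closed_ideal_mult_left[OF K dx] closed_ideal_mult_left[OF K dy]
        closed_ideal_mult_right[OF K eC] closed_ideal_mult_right[OF K eB])
  moreover have "ext_d M (C (k + 1) * ?x + B (k - 1) * ?y)
    = eC * ?x + C (k + 1) * (ext_d M ?x - scal M \<i> * rho M * ?x)
      + (eB * ?y + B (k - 1) * (ext_d M ?y + scal M \<i> * rho M * ?y))"
  proof -
    have squares: "?x * ?x = 0" "?y * ?y = 0" and swap: "?y * ?x = - (?x * ?y)"
      using one_form_square xi_Forms xi_bar_Forms one_forms_anticommute by blast+
    show ?thesis
      unfolding eC_def eB_def d_add d_Leibniz[OF coefficients_Forms(2)] d_Leibniz[OF coefficients_Forms(3)]
      by (simp add: mult.assoc distrib_left distrib_right left_diff_distrib right_diff_distrib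
          squares swap zero_form_scal coefficients_Forms)
  qed
  ultimately show ?thesis by simp
qed

lemma trace_killing_euler_phi_lambda:
  "trace (ms_mult Y (ms_euler (phi_lambda M)) k)
     = jet M 2 * (B (k + 1) * xi M) + fbar M (jet M 2) * (C (k - 1) * fbar M (xi M))
       - scal M (complex_of_real (gam M)) * (C (k + 1) * xi M + B (k - 1) * fbar M (xi M))"
proof -
  let ?p = "\<lambda>i j n. of_int n * phi_lambda M n $ i $ j"
  have diagonal: "conv f (?p 1 1) k = 0" "conv f (?p 2 2) k = 0" for f
    by (intro conv_eq_zero; simp add: phi_lambda_entry)+
  have c: "conv (\<lambda>n. 2 * C n) (?p 2 1) k = fbar M (jet M 2) * (C (k - 1) * fbar M (xi M))
      - scal M (complex_of_real (gam M)) * (C (k + 1) * xi M)"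
    by (subst conv_supported_at_pm1; simp add: phi_lambda_entry normalize_products)
  have b: "conv (\<lambda>n. 2 * B n) (?p 1 2) k = jet M 2 * (B (k + 1) * xi M)
      - scal M (complex_of_real (gam M)) * (B (k - 1) * fbar M (xi M))"
    by (subst conv_supported_at_pm1; simp add: phi_lambda_entry normalize_products)
  have "trace (ms_mult Y (ms_euler (phi_lambda M)) k)
      = conv (\<lambda>n. 2 * C n) (?p 2 1) k + conv (\<lambda>n. 2 * B n) (?p 1 2) k"
    by (simp only: trace_def ms_mult_entry ms_euler_entry sum_2 killing_entry diagonal add_0_left add_0_right)
  then show ?thesis
    unfolding b c by (simp add: algebra_simps)
qed

text \<open>
  The flow part generates only multiples of \<open>dt\<^sub>m\<close>, \<open>dtbar\<^sub>m\<close>, both in the trace and in the Killing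
  equation of the hierarchy, so both may be computed with \<open>\<phi>\<^sub>\<lambda>\<close>. In the sum with \<open>i da\<close> the terms
  containing \<open>h\<^sub>2\<close> cancel and those containing \<open>\<gamma>\<close> double.
\<close>

lemma varphi_Y_modulo_flows:
  "varphi_Y M a b c k + scal M \<i> * ext_d M (A k)
     + 2 * scal M (complex_of_real (gam M)) * (C (k + 1) * xi M + B (k - 1) * fbar M (xi M))
   \<in> ideal_gen (hierarchy_ideal M a b c \<union> dt_beyond M 0)"
proof -
  let ?K = "ideal_gen (hierarchy_ideal M a b c \<union> dt_beyond M 0)"
  have K: "closed_ideal ?K" by (rule closed_ideal_ideal_gen)
  have "tail_ideal 0 \<subseteq> ?K" by (intro ideal_gen_mono) auto
  then have flow: "ms_entries flow_part \<subseteq> ?K"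
    using flow_part_tail_ideal[of 0] unfolding ms_entries_def by blast
  have "ms_entries (\<lambda>k. ms_d M Y k + ms_comm \<Phi> Y k) \<subseteq> hierarchy_eqs M a b c"
    unfolding hierarchy_eqs_def Let_def by blast
  then have gens: "ms_entries (\<lambda>k. ms_d M Y k + ms_comm \<Phi> Y k) \<subseteq> ?K"
    using diff_ideal_gen_superset[of "hierarchy_eqs M a b c" M]
      ideal_gen_superset[of "hierarchy_ideal M a b c \<union> dt_beyond M 0"]
    unfolding hierarchy_ideal_def by blast
  have \<Phi>: "\<Phi> = (\<lambda>k. phi_lambda M k + flow_part k)"
    by (simp add: fun_eq_iff phi_ext_eq)
  have comm: "ms_comm \<Phi> Y n = ms_comm (phi_lambda M) Y n + (ms_mult flow_part Y n - ms_mult Y flow_part n)" for n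
    unfolding ms_comm_def \<Phi>
    using ms_mult_add_left[OF homogeneous_phi_lambda homogeneous_flow_part homogeneous_killing]
      ms_mult_add_right[OF homogeneous_killing homogeneous_phi_lambda homogeneous_flow_part]
      null_phi_lambda null_flow_part
    by simp
  have "ms_entries (\<lambda>k. ms_d M Y k + ms_comm (phi_lambda M) Y k) \<subseteq> ?K"
  proof -
    have "(ms_d M Y n + ms_comm \<Phi> Y n) $ i $ j
        - (ms_mult flow_part Y n $ i $ j - ms_mult Y flow_part n $ i $ j) \<in> ?K" for n i j
      using gens flow by (intro closed_ideal_diff[OF K] ms_mult_in_ideal[OF K]) (auto simp: ms_entries_def)
    then show ?thesis by (auto simp: ms_entries_def comm)
  qed
  note da = killing_equation_components(1)[OF K this, of k]
  have rest: "trace (ms_mult Y (ms_euler flow_part) k) \<in> ?K"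
    using ms_euler_in_ideal[OF K flow] by (intro ms_mult_in_ideal(2)[OF K]) simp
  have split: "varphi_Y M a b c k
      = trace (ms_mult Y (ms_euler (phi_lambda M)) k) + trace (ms_mult Y (ms_euler flow_part) k)"
  proof -
    have "ms_euler \<Phi> = (\<lambda>k. ms_euler (phi_lambda M) k + ms_euler flow_part k)"
      by (simp add: \<Phi> fun_eq_iff ms_euler_add)
    then show ?thesis
      unfolding varphi_Y_def trace_linear[symmetric]
      using ms_mult_add_right[OF homogeneous_killing homogeneous_ms_euler[OF homogeneous_phi_lambda]
          homogeneous_ms_euler[OF homogeneous_flow_part]]
        null_ms_euler[OF null_phi_lambda] null_ms_euler[OF null_flow_part]
      by simp
  qed
  have regroup: "h - g * z + t + da + 2 * g * z = (da + g * z + h) + t" for g h z t da :: 'a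
    by (simp add: mult_2 algebra_simps)
  show ?thesis
    unfolding split trace_killing_euler_phi_lambda regroup
    by (rule closed_ideal_add[OF K da rest])
qed

end

theorem theorem9p1:
  fixes M :: "('a :: {ring_1, topological_ab_group_add, topological_semigroup_mult, t2_space}, 'b)
                cmc_data_scheme"
    and a b c :: "nat \<Rightarrow> 'a"
  assumes "cmc_forms M"
    and "canonical_killing M a b c"
  shows "(\<forall>k. ext_d M (varphi_Y M a b c k) \<in> hierarchy_ideal M a b c) \<and>
         (\<forall>k. odd k \<longrightarrow> varphi_Y M a b c k = 0) \<and>
         (\<forall>k. represents_conservation_law M (hierarchy_ideal M a b c) (varphi_Y M a b c k)) \<and>
         (\<forall>n. represents_conservation_law M (cmc_ideal M) (varphi M b c n)) \<and>
         (\<forall>k. varphi_Y M a b c k + scal M \<i> * ext_d M (ser_a a k)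
              - (if k \<ge> 0 \<and> even k
                 then - (2 * scal M (complex_of_real (gam M)) * varphi M b c (nat k div 2)) else 0)
            \<in> ideal_gen (hierarchy_ideal M a b c \<union> dt_beyond M 0))"
proof (intro conjI allI impI)
  interpret cmc_forms M by fact
  interpret cmc_killing M a b c by unfold_locales fact
  fix k :: int and n :: nat
  show "ext_d M (varphi_Y M a b c k) \<in> hierarchy_ideal M a b c"
    by (rule d_varphi_Y)
  show "varphi_Y M a b c k = 0" if "odd k"
    using that by (rule varphi_Y_odd)
  show "represents_conservation_law M (hierarchy_ideal M a b c) (varphi_Y M a b c k)"
    unfolding represents_conservation_law_def using varphi_Y_Forms d_varphi_Y by simp
  show "represents_conservation_law M (cmc_ideal M) (varphi M b c n)"
    unfolding represents_conservation_law_def varphi_eq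
    using d_cmc_conservation_law[of "2 * int n"] coefficients_Forms xi_Forms xi_bar_Forms
    by (auto intro!: Forms_add Forms_mult_0)
  show "varphi_Y M a b c k + scal M \<i> * ext_d M (ser_a a k)
      - (if k \<ge> 0 \<and> even k
         then - (2 * scal M (complex_of_real (gam M)) * varphi M b c (nat k div 2)) else 0)
    \<in> ideal_gen (hierarchy_ideal M a b c \<union> dt_beyond M 0)"
  proof (cases "k \<ge> 0 \<and> even k")
    case True
    then have "varphi M b c (nat k div 2) = C (k + 1) * xi M + B (k - 1) * fbar M (xi M)"
      by (simp add: varphi_eq zdiv_int)
    then show ?thesis using True varphi_Y_modulo_flows[of k] by simp
  next
    case False
    \<comment> \<open>For odd \<open>k\<close> the degrees \<open>k + 1\<close>, \<open>k - 1\<close> are even; for even \<open>k < 0\<close> both are negative.\<close>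
    then have "C (k + 1) = 0" "B (k - 1) = 0"
      by (auto simp: ser_bc_def)
    then show ?thesis
      using varphi_Y_modulo_flows[of k] unfolding if_not_P[OF False] by simp
  qed
qed

end
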